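(* Let $a_1<\cdots<a_n$ be integers, $\chi(x)=(x-a_1)\cdots(x-a_n)$ and $R=\mathbb{Z}[x]/(\chi(x))$. (i) Assume $n=2$ and $a_2-a_1\geq 3$. Then the group $\mathrm{Cl}(R)$ is isomorphic to the quotient of the group $(\mathbb{Z}/(a_2-a_1))^\times$ by the subgroup $\{\pm 1\}$. (ii) Assume $n=3$, $a_3-a_1\geq 4$, and $\Delta_1=1$, where $\Delta_1=\gcd(a_2-a_1,a_3-a_1,a_3-a_2)$. Then the group $\mathrm{Cl}(R)$ is isomorphic to the quotient of the group $$\left(\mathbb{Z}/(a_2-a_1)\right)^\times\times\left(\mathbb{Z}/(a_3-a_2)\right)^\times\times\left(\mathbb{Z}/(a_3-a_1)\right)^\times$$ by the subgroup $\{(1,1,1),(1,-1,-1),(-1,1,-1),(-1,-1,1)\}$.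
   Context: Put $K=\mathbb{Q}\otimes_{\mathbb{Z}}R\cong\mathbb{Q}[x]/(\chi(x))$. A fractional $R$-ideal is an $R$-submodule $I\subset K$ that is a free $\mathbb{Z}$-module of rank $n$. Fractional ideals are multiplied in the usual way. Two fractional $R$-ideals $I,J$ are equivalent if $I=kJ$ for some $k\in K^\times$. The ideal class monoid $\mathrm{ICM}(R)$ is the monoid of equivalence classes of fractional $R$-ideals. A fractional $R$-ideal $I$ is invertible if $IJ=R$ for some fractional $R$-ideal $J$. The ideal class group $\mathrm{Cl}(R)$ is the subgroup of $\mathrm{ICM}(R)$ consisting of classes of invertible fractional $R$-ideals. Here $\mathbb{Z}/(m)$ denotes the ring of integers modulo $m$ (the zero ring, with trivial unit group, if $m=1$). *)

theory Defs
  imports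
    "HOL-Algebra.Algebra"
    "HOL-Algebra.Algebraic_Closure_Type"
    "HOL-Computational_Algebra.Polynomial"
begin

definition chi :: "(nat \<Rightarrow> int) \<Rightarrow> nat \<Rightarrow> int poly" where
  "chi a n = (\<Prod>i=1..n. [:- a i, 1:])"

abbreviation Zx :: "int poly ring" where
  "Zx \<equiv> ring_of_type_algebra"

abbreviation Qx :: "rat poly ring" where
  "Qx \<equiv> ring_of_type_algebra"

text \<open>Throughout, \<open>f\<close> is meant to be a monic integer polynomial; then \<open>order_ring f\<close> is
  free over the integers of rank \<open>degree f\<close>.\<close>

definition order_ring :: "int poly \<Rightarrow> int poly set ring" where
  "order_ring f = Zx Quot (PIdl\<^bsub>Zx\<^esub> f)"

definition K_ring :: "int poly \<Rightarrow> rat poly set ring" where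
  "K_ring f = Qx Quot (PIdl\<^bsub>Qx\<^esub> (map_poly rat_of_int f))"

text \<open>The ring homomorphism from \<open>\<int>[x]/(f)\<close> to \<open>\<rat>[x]/(f)\<close> that sends the coset of \<open>p\<close> to the
  coset of \<open>p\<close>.  The cosets of the representatives of one class \<open>r\<close> all coincide, so the union
  is this common coset.\<close>

definition to_K :: "int poly \<Rightarrow> int poly set \<Rightarrow> rat poly set" where
  "to_K f r = (\<Union>p\<in>r. PIdl\<^bsub>Qx\<^esub> (map_poly rat_of_int f) +>\<^bsub>Qx\<^esub> map_poly rat_of_int p)"

text \<open>\<open>\<rat> \<otimes> \<int>[x]/(f)\<close>, in its model \<open>\<rat>[x]/(f)\<close>, as an algebra over \<open>\<int>[x]/(f)\<close>.\<close>

definition K_alg :: "int poly \<Rightarrow> (int poly set, rat poly set) module" where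
  "K_alg f = ring.extend (K_ring f)
     (module.fields (\<lambda>r x. to_K f r \<otimes>\<^bsub>K_ring f\<^esub> x))"

definition fractional_ideal :: "int poly \<Rightarrow> rat poly set set \<Rightarrow> bool" where
  "fractional_ideal f I \<longleftrightarrow>
     submodule I (order_ring f) (K_alg f) \<and>
     (add_monoid (K_alg f))\<lparr>carrier := I\<rparr> \<cong> free_Abelian_group {..<Polynomial.degree f}"

definition unit_ideal :: "int poly \<Rightarrow> rat poly set set" where
  "unit_ideal f = to_K f ` carrier (order_ring f)"

text \<open>\<open>ideal_prod (K_alg f) I J\<close> consists of the finite sums of products of an element of \<open>I\<close>
  and an element of \<open>J\<close>.\<close>

definition invertible_ideal :: "int poly \<Rightarrow> rat poly set set \<Rightarrow> bool" where
  "invertible_ideal f I \<longleftrightarrow> fractional_ideal f I \<and>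
     (\<exists>J. fractional_ideal f J \<and> ideal_prod (K_alg f) I J = unit_ideal f)"

definition ideal_equiv :: "int poly \<Rightarrow> (rat poly set set \<times> rat poly set set) set" where
  "ideal_equiv f = {(I, J). fractional_ideal f I \<and> fractional_ideal f J \<and>
     (\<exists>k\<in>Units (K_alg f). I = k <#\<^bsub>K_alg f\<^esub> J)}"

definition ICM :: "int poly \<Rightarrow> rat poly set set set monoid" where
  "ICM f = \<lparr>carrier = {I. fractional_ideal f I} // ideal_equiv f,
     monoid.mult = (\<lambda>C D. \<Union>I\<in>C. \<Union>J\<in>D. ideal_equiv f `` {ideal_prod (K_alg f) I J}),
     one = ideal_equiv f `` {unit_ideal f}\<rparr>"

definition Cl :: "int poly \<Rightarrow> rat poly set set set monoid" where
  "Cl f = (ICM f)\<lparr>carrier := {ideal_equiv f `` {I} | I. invertible_ideal f I}\<rparr>"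

text \<open>The ring \<open>ZFact 1\<close> is the zero ring and its unit group is trivial, as it should be; in contrast,
  \<open>residue_ring 1\<close> has an empty set of units.\<close>

abbreviation ZUnits :: "int \<Rightarrow> int set monoid" where
  "ZUnits m \<equiv> units_of (ZFact m)"

abbreviation pos1 :: "int \<Rightarrow> int set" where
  "pos1 m \<equiv> \<one>\<^bsub>ZFact m\<^esub>"

abbreviation neg1 :: "int \<Rightarrow> int set" where
  "neg1 m \<equiv> \<ominus>\<^bsub>ZFact m\<^esub> \<one>\<^bsub>ZFact m\<^esub>"

end

theory Submission
  imports Defs "HOL-Library.Function_Algebras" "HOL-Number_Theory.Cong"
begin

text \<open>
  Let \<open>S\<close> be the set of roots.  Evaluation at the roots identifies \<open>K\<close> with \<open>\<rat>\<^sup>S\<close> and \<open>R\<close> with the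
  ring of value vectors of integer polynomials, a subring of the maximal order \<open>\<int>\<^sup>S\<close>.  A value
  vector \<open>u\<close> satisfies \<open>u b \<equiv> u c (mod c - b)\<close> for all roots \<open>b < c\<close>.  If the differences of the
  roots are pairwise coprime (an empty condition for two roots, the condition \<open>\<Delta>\<^sub>1 = 1\<close> for three),
  then Newton interpolation shows that these congruences describe \<open>R\<close> completely.

  The ideals of \<open>R\<close> that matter are the twists of this description: for a family \<open>t\<close> of units
  \<open>t b c\<close> modulo \<open>c - b\<close>, let \<open>glued S t\<close> be the set of all \<open>u \<in> \<int>\<^sup>S\<close> with
  \<open>u b \<equiv> t b c \<cdot> u c (mod c - b)\<close>.  Everything rests on three facts.

  \<^item> The product of \<open>glued S t\<close> and \<open>glued S s\<close> is \<open>glued S (t s)\<close> (\<open>prod_glued\<close>).  Indeed, by the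
    Chinese remainder theorem \<open>glued S t\<close> contains a vector \<open>\<alpha>\<close> whose coordinates are prime to
    the product \<open>N\<close> of all differences, multiplication by \<open>\<alpha>\<close> is invertible modulo \<open>N\<close> and carries
    the congruences of \<open>s\<close> to those of \<open>t s\<close>, and all these lattices contain \<open>N \<int>\<^sup>S\<close>.

  \<^item> Every invertible fractional ideal is a multiple of some \<open>glued S t\<close>
    (\<open>invertible_ideal_equiv_glued\<close>).  Given \<open>I J = R\<close>, each coordinate projection of \<open>I\<close> is a
    nonzero cyclic subgroup of \<open>\<rat>\<close>, so \<open>I\<close> may be scaled until all these projections are \<open>\<int>\<close>; then
    \<open>I\<close> and \<open>J\<close> both lie in \<open>\<int>\<^sup>S\<close>.  Working prime by prime, one finds \<open>\<alpha> \<in> I\<close> and \<open>\<beta> \<in> J\<close> with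
    coordinates prime to \<open>N\<close>.  For \<open>x \<in> I\<close> both \<open>x \<beta>\<close> and \<open>\<alpha> \<beta>\<close> lie in \<open>R\<close>, so the quotient
    \<open>x b / x c\<close> agrees with \<open>\<alpha> b / \<alpha> c\<close> modulo \<open>c - b\<close>, and this quotient is the family \<open>t\<close>.

  \<^item> The ideal \<open>glued S t\<close> is principal if and only if \<open>t b c \<equiv> \<sigma> b \<cdot> \<sigma> c\<close> for signs \<open>\<sigma>\<close>
    (\<open>glued_class_eq_one_iff\<close>), because a generator has to be a unit of \<open>\<int>\<^sup>S\<close>.

  Hence \<open>t \<mapsto> [glued S t]\<close> is a surjective homomorphism from the product of the unit groups
  \<open>(\<int>/(c - b))\<^sup>\<times>\<close> to the class group, and its kernel consists of the families \<open>\<sigma> b \<cdot> \<sigma> c\<close>.  For two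
  roots these are \<open>\<plusminus>1\<close>; for three roots they are the sign triples with product \<open>1\<close>.
\<close>

section \<open>Congruence lattices in the maximal order\<close>

text \<open>The ring \<open>\<int>\<^sup>S\<close>.  Its elements are extended by \<open>0\<close>, so that two of them are equal as functions
  if and only if their coordinates agree.\<close>
definition maximal_order :: "int set \<Rightarrow> (int \<Rightarrow> int) set" where
  "maximal_order S = {u. \<forall>c. c \<notin> S \<longrightarrow> u c = 0}"

definition eval_on :: "int set \<Rightarrow> int poly \<Rightarrow> int \<Rightarrow> int" where
  "eval_on S p = (\<lambda>c. if c \<in> S then poly p c else 0)"

text \<open>Here \<open>t b c\<close> prescribes the ratio of the coordinates at \<open>b\<close> and \<open>c\<close> modulo \<open>c - b\<close>.  Each pair of
  roots is used only in the order \<open>b < c\<close>, so \<open>t\<close> need not satisfy \<open>t c b = 1 / t b c\<close>.\<close>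
definition glued :: "int set \<Rightarrow> (int \<Rightarrow> int \<Rightarrow> int) \<Rightarrow> (int \<Rightarrow> int) set" where
  "glued S t = {u \<in> maximal_order S. \<forall>b\<in>S. \<forall>c\<in>S. b < c \<longrightarrow> [u b = t b c * u c] (mod (c - b))}"

definition unit_family :: "int set \<Rightarrow> (int \<Rightarrow> int \<Rightarrow> int) \<Rightarrow> bool" where
  "unit_family S t \<longleftrightarrow> (\<forall>b\<in>S. \<forall>c\<in>S. b < c \<longrightarrow> coprime (t b c) (c - b))"

text \<open>Up to sign the discriminant of the polynomial with root set \<open>S\<close>.  It serves as a common modulus:
  multiplication by it sends \<open>\<int>\<^sup>S\<close> into every \<open>glued S t\<close>.\<close>
definition diffs :: "int set \<Rightarrow> int" where
  "diffs S = (\<Prod>b\<in>S. \<Prod>c\<in>S - {b}. c - b)"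

abbreviation fun_ring :: "(int \<Rightarrow> int) ring" where
  "fun_ring \<equiv> ring_of_type_algebra"

text \<open>Subgroups of \<open>\<int>\<^sup>S\<close> that are stable under the order of value vectors.  Negatives need no separate
  clause, since the constant \<open>-1\<close> is a value vector.\<close>
definition eval_module :: "int set \<Rightarrow> (int \<Rightarrow> int) set \<Rightarrow> bool" where
  "eval_module S A \<longleftrightarrow> A \<subseteq> maximal_order S \<and> (\<forall>x\<in>A. \<forall>y\<in>A. x + y \<in> A) \<and>
     (\<forall>p. \<forall>x\<in>A. eval_on S p * x \<in> A)"

lemma ring_of_type_algebra_simps [simp]:
  "carrier (ring_of_type_algebra :: 'a :: ring_1 ring) = UNIV"
  "monoid.mult (ring_of_type_algebra :: 'a :: ring_1 ring) = (*)"
  "ring.add (ring_of_type_algebra :: 'a :: ring_1 ring) = (+)"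
  "monoid.one (ring_of_type_algebra :: 'a :: ring_1 ring) = 1"
  "ring.zero (ring_of_type_algebra :: 'a :: ring_1 ring) = 0"
  by (simp_all add: ring_of_type_algebra_def)

lemma diffs_nonzero: "finite S \<Longrightarrow> diffs S \<noteq> 0"
  by (auto simp: diffs_def)

lemma dvd_diffs:
  assumes "finite S" "b \<in> S" "c \<in> S" "b \<noteq> c"
  shows "c - b dvd diffs S"
proof -
  have "c - b dvd (\<Prod>c\<in>S - {b}. c - b)"
    using assms by (intro dvd_prodI) auto
  also have "\<dots> dvd diffs S"
    unfolding diffs_def using assms by (intro dvd_prodI) auto
  finally show ?thesis .
qed

lemma eval_on_in_maximal_order [simp]: "eval_on S p \<in> maximal_order S"
  by (simp add: eval_on_def maximal_order_def)

lemma poly_diff_dvd: "(b :: int) - c dvd poly p b - poly p c"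
proof (induction p)
  case (pCons a p)
  have "poly (pCons a p) b - poly (pCons a p) c = b * (poly p b - poly p c) + (b - c) * poly p c"
    by (simp add: algebra_simps)
  then show ?case using pCons by simp
qed auto

lemma eval_on_glued: "eval_on S p \<in> glued S (\<lambda>_ _. 1)"
proof -
  have "[poly p b = poly p c] (mod (c - b))" for b c :: int
    using poly_diff_dvd[of c b p] by (simp add: cong_iff_dvd_diff dvd_diff_commute)
  then show ?thesis
    by (auto simp: glued_def eval_on_def maximal_order_def)
qed

lemma glued_add: "x \<in> glued S t \<Longrightarrow> y \<in> glued S t \<Longrightarrow> x + y \<in> glued S t"
  by (auto simp: glued_def maximal_order_def distrib_left intro!: cong_add)

lemma glued_mult:
  assumes "x \<in> glued S t" "y \<in> glued S s"
  shows "x * y \<in> glued S (\<lambda>b c. t b c * s b c)"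
proof -
  have "[x b * y b = t b c * s b c * (x c * y c)] (mod (c - b))"
    if "b \<in> S" "c \<in> S" "b < c" for b c
  proof -
    have "[x b * y b = (t b c * x c) * (s b c * y c)] (mod (c - b))"
      using assms that by (intro cong_mult) (auto simp: glued_def)
    then show ?thesis by (simp add: mult_ac)
  qed
  then show ?thesis using assms by (auto simp: glued_def maximal_order_def)
qed

lemma eval_module_glued: "eval_module S (glued S t)"
  unfolding eval_module_def
proof (intro conjI allI ballI)
  fix p x assume "x \<in> glued S t"
  then show "eval_on S p * x \<in> glued S t"
    using glued_mult[OF eval_on_glued[of S p], of x t] by simp
qed (auto simp: glued_add, simp add: glued_def)

lemma conductor_in_glued:
  assumes "finite S" "z \<in> maximal_order S"
  shows "(\<lambda>c. diffs S * z c) \<in> glued S t"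
proof -
  have "[diffs S * z b = t b c * (diffs S * z c)] (mod (c - b))"
    if "b \<in> S" "c \<in> S" "b < c" for b c
    using dvd_diffs[OF assms(1) that(1,2)] that by (simp add: cong_iff_dvd_diff)
  then show ?thesis using assms by (auto simp: glued_def maximal_order_def)
qed

lemma coprime_diffs_imp:
  "finite S \<Longrightarrow> coprime x (diffs S) \<Longrightarrow> b \<in> S \<Longrightarrow> c \<in> S \<Longrightarrow> b < c \<Longrightarrow> coprime x (c - b)"
  using dvd_diffs[of S b c] coprime_divisors[of x x "c - b" "diffs S"] by auto

lemma inverse_mod_diffs:
  assumes "\<forall>c\<in>S. coprime (\<alpha> c) (diffs S)"
  obtains \<gamma> where "\<gamma> \<in> maximal_order S" "\<forall>c\<in>S. [\<alpha> c * \<gamma> c = 1] (mod diffs S)"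
proof -
  have "\<forall>c\<in>S. \<exists>g. [\<alpha> c * g = 1] (mod diffs S)"
    using assms cong_solve_coprime_int by blast
  then obtain g where "\<forall>c\<in>S. [\<alpha> c * g c = 1] (mod diffs S)"
    by metis
  then show ?thesis
    by (intro that[of "\<lambda>c. if c \<in> S then g c else 0"]) (auto simp: maximal_order_def)
qed

text \<open>Division by \<open>\<alpha>\<close> modulo the discriminant removes the twist \<open>t\<close>: in the congruence for \<open>u\<close> the
  factor \<open>t b c\<close> cancels against the one in \<open>\<alpha> b \<equiv> t b c \<cdot> \<alpha> c\<close>.\<close>
lemma inverse_glued:
  assumes "finite S" "\<alpha> \<in> glued S t" "\<forall>c\<in>S. [\<alpha> c * \<gamma> c = 1] (mod diffs S)"
    "u \<in> glued S (\<lambda>b c. t b c * s b c)" "\<gamma> \<in> maximal_order S"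
  shows "\<gamma> * u \<in> glued S s"
proof -
  have "[\<gamma> b * u b = s b c * (\<gamma> c * u c)] (mod (c - b))"
    if bc: "b \<in> S" "c \<in> S" "b < c" for b c
  proof -
    let ?m = "c - b"
    have d: "?m dvd diffs S" using dvd_diffs assms(1) bc by auto
    have ab: "[\<alpha> b * \<gamma> b = 1] (mod ?m)" and ac: "[\<alpha> c * \<gamma> c = 1] (mod ?m)"
      using assms(3) bc cong_dvd_modulus[OF _ d] by auto
    have "[\<gamma> b * u b = \<gamma> b * (t b c * s b c * u c)] (mod ?m)"
      using assms(4) bc by (intro cong_mult) (auto simp: glued_def)
    also have "\<gamma> b * (t b c * s b c * u c) = \<gamma> b * (t b c * s b c * u c) * 1"
      by simp
    also have "[\<gamma> b * (t b c * s b c * u c) * 1 = \<gamma> b * (t b c * s b c * u c) * (\<alpha> c * \<gamma> c)] (mod ?m)"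
      using ac by (intro cong_mult) (auto simp: cong_sym)
    also have "\<gamma> b * (t b c * s b c * u c) * (\<alpha> c * \<gamma> c) = (t b c * \<alpha> c) * (s b c * \<gamma> b * (\<gamma> c * u c))"
      by (simp add: mult_ac)
    also have "[\<dots> = \<alpha> b * (s b c * \<gamma> b * (\<gamma> c * u c))] (mod ?m)"
      using assms(2) bc by (intro cong_mult) (auto simp: glued_def cong_sym)
    also have "\<alpha> b * (s b c * \<gamma> b * (\<gamma> c * u c)) = (\<alpha> b * \<gamma> b) * (s b c * (\<gamma> c * u c))"
      by (simp add: mult_ac)
    also have "[\<dots> = 1 * (s b c * (\<gamma> c * u c))] (mod ?m)"
      using ab by (intro cong_mult) auto
    finally show ?thesis by simp
  qed
  then show ?thesis using assms(5) by (auto simp: glued_def maximal_order_def)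
qed

text \<open>The universal property of the ideal product, as sums of products.\<close>
lemma ideal_prod_mono: "ideal_prod R A B \<subseteq> C"
  if "\<And>x y. x \<in> A \<Longrightarrow> y \<in> B \<Longrightarrow> x \<otimes>\<^bsub>R\<^esub> y \<in> C" "\<And>x y. x \<in> C \<Longrightarrow> y \<in> C \<Longrightarrow> x \<oplus>\<^bsub>R\<^esub> y \<in> C"
proof
  fix x assume "x \<in> ideal_prod R A B"
  then show "x \<in> C" by induction (use that in auto)
qed

text \<open>Let \<open>\<gamma>\<close> invert \<open>\<alpha>\<close> modulo the discriminant \<open>N\<close>.  An element \<open>u\<close> of the right-hand side is
  \<open>\<alpha> \<cdot> (\<gamma> u)\<close> plus a multiple of \<open>N\<close>; the first summand is a product of the required shape by
  \<open>inverse_glued\<close>.  The multiples of \<open>N\<close> are in the product as well: \<open>\<alpha>\<close> and \<open>N\<close> generate the unit ideal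
  of \<open>\<int>\<^sup>S\<close>, and both factors contain \<open>N \<int>\<^sup>S\<close>.\<close>
lemma prod_glued:
  assumes S: "finite S" and a: "\<alpha> \<in> glued S t" "\<forall>c\<in>S. coprime (\<alpha> c) (diffs S)"
  shows "ideal_prod fun_ring (glued S t) (glued S s) = glued S (\<lambda>b c. t b c * s b c)"
    (is "?P = ?G")
proof
  show "?P \<subseteq> ?G"
    by (rule ideal_prod_mono) (auto simp: glued_mult glued_add)
next
  let ?N = "diffs S"
  obtain \<gamma> where g: "\<gamma> \<in> maximal_order S" "\<forall>c\<in>S. [\<alpha> c * \<gamma> c = 1] (mod ?N)"
    using inverse_mod_diffs a(2) by blast
  have mul: "x * y \<in> ?P" if "x \<in> glued S t" "y \<in> glued S s" for x y
    using ideal_prod.prod[OF that, of fun_ring] by simp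
  have add: "x + y \<in> ?P" if "x \<in> ?P" "y \<in> ?P" for x y
    using ideal_prod.sum[OF that] by simp
  have "\<forall>c\<in>S. \<exists>w. 1 - \<alpha> c * \<gamma> c = ?N * w"
    using g(2) by (metis cong_iff_dvd_diff cong_sym dvdE)
  then obtain w where w: "\<forall>c\<in>S. 1 - \<alpha> c * \<gamma> c = ?N * w c" by metis
  \<comment> \<open>\<open>N z = \<alpha> \<cdot> (N \<gamma> z) + (N w z) \<cdot> N\<close>, where \<open>1 - \<alpha> \<gamma> = N w\<close>\<close>
  have cond: "(\<lambda>c. ?N * z c) \<in> ?P" if z: "z \<in> maximal_order S" for z
  proof -
    have "\<alpha> * (\<lambda>c. ?N * (\<gamma> c * z c)) + (\<lambda>c. ?N * (w c * z c)) * (\<lambda>c. ?N * (if c \<in> S then 1 else 0)) \<in> ?P"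
      using z g by (intro add mul a conductor_in_glued S) (auto simp: maximal_order_def)
    also have "\<alpha> * (\<lambda>c. ?N * (\<gamma> c * z c)) + (\<lambda>c. ?N * (w c * z c)) * (\<lambda>c. ?N * (if c \<in> S then 1 else 0))
      = (\<lambda>c. ?N * z c)"
    proof
      fix c
      show "(\<alpha> * (\<lambda>c. ?N * (\<gamma> c * z c)) + (\<lambda>c. ?N * (w c * z c)) * (\<lambda>c. ?N * (if c \<in> S then 1 else 0))) c
        = ?N * z c"
      proof (cases "c \<in> S")
        case True
        have "\<alpha> c * (?N * (\<gamma> c * z c)) + ?N * (w c * z c) * ?N = (\<alpha> c * \<gamma> c + ?N * w c) * (?N * z c)"
          by (simp add: algebra_simps)
        also have "\<alpha> c * \<gamma> c + ?N * w c = 1" using w True by auto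
        finally show ?thesis using True by simp
      qed (use z in \<open>auto simp: maximal_order_def\<close>)
    qed
    finally show ?thesis .
  qed
  show "?G \<subseteq> ?P"
  proof
    fix u assume u: "u \<in> ?G"
    then have ul: "u \<in> maximal_order S" by (simp add: glued_def)
    have "\<alpha> * (\<gamma> * u) + (\<lambda>c. ?N * (w c * u c)) \<in> ?P"
      using ul u g a by (intro add mul cond inverse_glued[OF S a(1)]) (auto simp: maximal_order_def)
    also have "\<alpha> * (\<gamma> * u) + (\<lambda>c. ?N * (w c * u c)) = u"
    proof
      fix c
      show "(\<alpha> * (\<gamma> * u) + (\<lambda>c. ?N * (w c * u c))) c = u c"
      proof (cases "c \<in> S")
        case True
        have "\<alpha> c * (\<gamma> c * u c) + ?N * (w c * u c) = (\<alpha> c * \<gamma> c + ?N * w c) * u c"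
          by (simp add: algebra_simps)
        also have "\<alpha> c * \<gamma> c + ?N * w c = 1" using w True by auto
        finally show ?thesis by simp
      qed (use ul in \<open>auto simp: maximal_order_def\<close>)
    qed
    finally show "u \<in> ?P" .
  qed
qed

section \<open>Every invertible module is a congruence lattice\<close>

lemma eval_moduleD:
  assumes "eval_module S A"
  shows "A \<subseteq> maximal_order S" "\<And>x y. x \<in> A \<Longrightarrow> y \<in> A \<Longrightarrow> x + y \<in> A"
    "\<And>p x. x \<in> A \<Longrightarrow> eval_on S p * x \<in> A"
  using assms by (auto simp: eval_module_def)

text \<open>Fix a prime \<open>p\<close>.  Value vectors are constant modulo \<open>p\<close> on each class of roots modulo \<open>p\<close>.  Since
  \<open>1\<close> is a sum of products \<open>x y\<close> with \<open>x \<in> A\<close> and \<open>y \<in> B\<close>, some such product is nonzero modulo \<open>p\<close> at the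
  root \<open>b\<close>; being a value vector, it is nonzero on the whole class of \<open>b\<close>, and so is its factor \<open>x\<close>.
  This is where invertibility enters: for a general module different elements may be required at
  different roots of one class.\<close>
lemma exists_nondividing_on_class:
  assumes A: "eval_module S A" and AB: "ideal_prod fun_ring A B = range (eval_on S)"
    and p: "Factorial_Ring.prime p" and b: "b \<in> S"
  shows "\<exists>x\<in>A. \<forall>c\<in>S. [c = b] (mod p) \<longrightarrow> \<not> p dvd x c"
proof -
  have "\<exists>x\<in>A. \<exists>y\<in>B. \<not> p dvd x b * y b"
  proof (rule ccontr)
    assume "\<not> ?thesis"
    then have "ideal_prod fun_ring A B \<subseteq> {z. p dvd z b}"
      by (intro ideal_prod_mono) auto
    then have "p dvd eval_on S 1 b" unfolding AB by auto
    then show False using b p by (simp add: eval_on_def not_prime_unit)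
  qed
  then obtain x y where xy: "x \<in> A" "y \<in> B" "\<not> p dvd x b * y b" by blast
  have "x * y \<in> range (eval_on S)"
    using ideal_prod.prod[OF xy(1,2), of fun_ring] AB by simp
  then obtain q where q: "x * y = eval_on S q" by auto
  have "\<not> p dvd x c" if c: "c \<in> S" "[c = b] (mod p)" for c
  proof
    assume "p dvd x c"
    then have "p dvd poly q c" using fun_cong[OF q, of c] c by (simp add: eval_on_def) (metis dvd_mult2)
    moreover have "p dvd poly q c - poly q b"
      using c(2) poly_diff_dvd[of c b q] by (auto simp: cong_iff_dvd_diff intro: dvd_trans)
    ultimately have "p dvd poly q b" by (metis dvd_diff_right_iff dvd_diff_commute)
    then show False using fun_cong[OF q, of b] b xy(3) by (simp add: eval_on_def)
  qed
  then show ?thesis using xy(1) by blast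
qed

text \<open>The elements found for the single classes are combined with polynomial weights that vanish
  modulo \<open>p\<close> on the classes where they must not interfere.\<close>
lemma exists_nondividing:
  assumes S: "finite S" and A: "eval_module S A" and ne: "A \<noteq> {}"
    and AB: "ideal_prod fun_ring A B = range (eval_on S)" and p: "Factorial_Ring.prime p"
  shows "\<exists>x\<in>A. \<forall>c\<in>S. \<not> p dvd x c"
proof -
  have "\<exists>x\<in>A. \<forall>c\<in>S. (\<exists>b\<in>T. [c = b] (mod p)) \<longrightarrow> \<not> p dvd x c" if "finite T" "T \<subseteq> S" for T
    using that
  proof (induction T)
    case empty then show ?case using ne by auto
  next
    case (insert b T)
    then obtain x where x: "x \<in> A" "\<forall>c\<in>S. (\<exists>b\<in>T. [c = b] (mod p)) \<longrightarrow> \<not> p dvd x c" by auto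
    obtain y where y: "y \<in> A" "\<forall>c\<in>S. [c = b] (mod p) \<longrightarrow> \<not> p dvd y c"
      using exists_nondividing_on_class[OF A AB p] insert.prems by blast
    \<comment> \<open>On \<open>S\<close>, the polynomial \<open>q\<close> is nonzero modulo \<open>p\<close> exactly on the class of \<open>b\<close>, and \<open>X - b\<close>
      exactly off this class.\<close>
    define D where "D = {c \<in> S. \<not> [c = b] (mod p)}"
    define q where "q = (\<Prod>c\<in>D. [:- c, 1:])"
    define z where "z = eval_on S [:- b, 1:] * x + eval_on S q * y"
    have finD: "finite D" using S by (simp add: D_def)
    have polyq: "poly q c = (\<Prod>d\<in>D. c - d)" for c by (simp add: q_def poly_prod)
    have "\<not> p dvd z c" if c: "c \<in> S" "\<exists>b\<in>insert b T. [c = b] (mod p)" for c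
    proof (cases "[c = b] (mod p)")
      case True
      have "\<not> p dvd poly q c"
      proof
        assume "p dvd poly q c"
        then obtain d where "d \<in> D" "p dvd c - d"
          using p finD by (auto simp: polyq prime_dvd_prod_iff)
        then show False using True by (auto simp: D_def) (metis cong_iff_dvd_diff cong_sym cong_trans)
      qed
      then have "\<not> p dvd poly q c * y c" using y(2) c True p by (simp add: prime_dvd_mult_iff)
      moreover have "p dvd (c - b) * x c" using True by (simp add: cong_iff_dvd_diff)
      moreover have "z c = (c - b) * x c + poly q c * y c" using c by (simp add: z_def eval_on_def)
      ultimately show ?thesis by (metis dvd_add_right_iff)
    next
      case False
      then have "poly q c = 0" using finD c by (auto simp: polyq D_def)
      then have "z c = (c - b) * x c" using c by (simp add: z_def eval_on_def)
      then show ?thesis using False x(2) c p by (auto simp: prime_dvd_mult_iff cong_iff_dvd_diff)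
    qed
    moreover have "z \<in> A" unfolding z_def by (intro eval_moduleD[OF A] x y)
    ultimately show ?case by blast
  qed
  from this[OF S order_refl] show ?thesis by (meson cong_refl)
qed

text \<open>The elements found for the single primes are combined with integer weights, as in the Chinese
  remainder theorem.\<close>
lemma exists_coprime_element:
  assumes S: "finite S" and A: "eval_module S A" and ne: "A \<noteq> {}"
    and AB: "ideal_prod fun_ring A B = range (eval_on S)" and N: "N \<noteq> 0"
  shows "\<exists>x\<in>A. \<forall>c\<in>S. coprime (x c) (N :: int)"
proof -
  have "\<exists>x\<in>A. \<forall>p\<in>P. \<forall>c\<in>S. \<not> p dvd x c" if "finite P" "\<forall>p\<in>P. Factorial_Ring.prime p" for P
    using that
  proof (induction P)
    case empty then show ?case using ne by auto
  next
    case (insert q P)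
    then obtain x where x: "x \<in> A" "\<forall>p\<in>P. \<forall>c\<in>S. \<not> p dvd x c" by auto
    obtain y where y: "y \<in> A" "\<forall>c\<in>S. \<not> q dvd y c"
      using exists_nondividing[OF S A ne AB] insert.prems by blast
    define z where "z = eval_on S [:q:] * x + eval_on S [:\<Prod>P:] * y"
    have z: "z c = q * x c + \<Prod>P * y c" if "c \<in> S" for c using that by (simp add: z_def eval_on_def)
    have "\<not> p dvd z c" if p: "p \<in> insert q P" and c: "c \<in> S" for p c
    proof (cases "p = q")
      case True
      have "\<not> q dvd \<Prod>P"
      proof
        assume "q dvd \<Prod>P"
        then obtain r where "r \<in> P" "q dvd r" using insert by (auto simp: prime_dvd_prod_iff)
        then show False using insert by (metis insertCI primes_dvd_imp_eq)
      qed
      then have "\<not> q dvd \<Prod>P * y c" using y c insert.prems by (simp add: prime_dvd_mult_iff)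
      then show ?thesis using z[OF c] True by (simp add: dvd_add_right_iff)
    next
      case False
      then have "p \<in> P" using p by simp
      moreover have "\<not> p dvd q" using False p insert.prems by (metis insertCI primes_dvd_imp_eq)
      ultimately have "\<not> p dvd q * x c" using x c insert.prems by (simp add: prime_dvd_mult_iff)
      moreover have "p dvd \<Prod>P * y c" using dvd_prodI[OF insert.hyps(1) \<open>p \<in> P\<close>, of "\<lambda>x. x"] by simp
      ultimately show ?thesis using z[OF c] by (simp add: dvd_add_left_iff)
    qed
    moreover have "z \<in> A" unfolding z_def by (intro eval_moduleD[OF A] x y)
    ultimately show ?case by blast
  qed
  from this[of "prime_factors N"] obtain x where x: "x \<in> A" "\<forall>p\<in>prime_factors N. \<forall>c\<in>S. \<not> p dvd x c"
    by auto
  have "coprime (x c) N" if "c \<in> S" for c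
  proof (rule ccontr)
    assume "\<not> coprime (x c) N"
    then obtain d where "d dvd x c" "d dvd N" "\<not> is_unit d" by (auto simp: coprime_def)
    moreover from this N have "d \<noteq> 0" by auto
    ultimately obtain p where "Factorial_Ring.prime p" "p dvd d" by (metis prime_divisor_exists)
    then have "p dvd x c" "p \<in> prime_factors N"
      using \<open>d dvd x c\<close> \<open>d dvd N\<close> N by (auto simp: in_prime_factors_iff intro: dvd_trans)
    then show False using x(2) that by auto
  qed
  then show ?thesis using x(1) by blast
qed

lemma ideal_prod_commute_fun: "ideal_prod fun_ring A B = ideal_prod fun_ring B A"
proof -
  have "ideal_prod fun_ring A B \<subseteq> ideal_prod fun_ring B A" for A B
  proof (rule ideal_prod_mono)
    show "x \<otimes>\<^bsub>fun_ring\<^esub> y \<in> ideal_prod fun_ring B A" if "x \<in> A" "y \<in> B" for x y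
      using ideal_prod.prod[OF that(2,1), of fun_ring] by (simp add: mult.commute)
  qed (rule ideal_prod.sum)
  then show ?thesis by blast
qed

text \<open>Choose \<open>\<alpha> \<in> A\<close> and \<open>\<beta> \<in> B\<close> with coordinates prime to the discriminant \<open>N\<close>, and let
  \<open>t b c = \<alpha> b / \<alpha> c\<close>.  For \<open>x \<in> A\<close> the vectors \<open>x \<beta>\<close> and \<open>\<alpha> \<beta>\<close> satisfy the untwisted congruences;
  dividing one by the other gives \<open>x b \<equiv> t b c \<cdot> x c\<close>.  Conversely, if \<open>u\<close> satisfies the twisted
  congruences, then \<open>u / \<alpha>\<close> satisfies the untwisted ones modulo \<open>N\<close>, so it is a value vector up to
  multiples of \<open>N\<close>, and \<open>A\<close> contains \<open>N \<int>\<^sup>S\<close> because each of its coordinate projections is onto.\<close>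
lemma invertible_eval_module_is_glued:
  assumes S: "finite S" and A: "eval_module S A" and B: "eval_module S B"
    and AB: "ideal_prod fun_ring A B = range (eval_on S)"
    and R: "glued S (\<lambda>_ _. 1) \<subseteq> range (eval_on S)"
    and one: "\<And>c. c \<in> S \<Longrightarrow> \<exists>x\<in>A. x c = 1"
  shows "\<exists>t. unit_family S t \<and> A = glued S t"
proof -
  let ?N = "diffs S"
  have "A \<noteq> {} \<and> B \<noteq> {}" if "x \<in> ideal_prod fun_ring A B" for x
    using that by induction auto
  then have ne: "A \<noteq> {}" "B \<noteq> {}" using AB by blast+
  have BA: "ideal_prod fun_ring B A = range (eval_on S)" using AB ideal_prod_commute_fun by metis
  obtain \<alpha> where \<alpha>: "\<alpha> \<in> A" "\<forall>c\<in>S. coprime (\<alpha> c) ?N"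
    using exists_coprime_element[OF S A ne(1) AB diffs_nonzero[OF S]] by blast
  obtain \<beta> where \<beta>: "\<beta> \<in> B" "\<forall>c\<in>S. coprime (\<beta> c) ?N"
    using exists_coprime_element[OF S B ne(2) BA diffs_nonzero[OF S]] by blast
  obtain \<gamma> where \<gamma>: "\<gamma> \<in> maximal_order S" "\<forall>c\<in>S. [\<alpha> c * \<gamma> c = 1] (mod ?N)"
    using inverse_mod_diffs \<alpha>(2) by blast
  define t where "t = (\<lambda>b c. \<alpha> b * \<gamma> c)"
  have mod1: "[\<alpha> c * \<gamma> c = 1] (mod (c - b))" "[\<alpha> b * \<gamma> b = 1] (mod (c - b))"
    if "b \<in> S" "c \<in> S" "b < c" for b c
    using cong_dvd_modulus[OF _ dvd_diffs[OF S that(1,2)]] \<gamma>(2) that by auto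
  have unit: "unit_family S t"
    unfolding unit_family_def
  proof (intro ballI impI)
    fix b c assume bc: "b \<in> S" "c \<in> S" "b < c"
    have "coprime (\<gamma> c) (c - b)"
      using mod1(1)[OF bc] by (metis coprime_iff_invertible_int mult.commute)
    moreover have "coprime (\<alpha> b) (c - b)" using coprime_diffs_imp[OF S _ bc] \<alpha>(2) bc by auto
    ultimately show "coprime (t b c) (c - b)" by (simp add: t_def)
  qed
  have \<alpha>t: "\<alpha> \<in> glued S t"
    unfolding glued_def
  proof (intro CollectI conjI ballI impI)
    fix b c assume bc: "b \<in> S" "c \<in> S" "b < c"
    have "[\<alpha> b * 1 = \<alpha> b * (\<alpha> c * \<gamma> c)] (mod (c - b))"
      using mod1(1)[OF bc] by (intro cong_mult) (auto simp: cong_sym)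
    then show "[\<alpha> b = t b c * \<alpha> c] (mod (c - b))" by (simp add: t_def mult_ac)
  qed (use \<alpha> A in \<open>auto simp: eval_module_def\<close>)
  have "A \<subseteq> glued S t"
  proof
    fix x assume x: "x \<in> A"
    have in1: "x * \<beta> \<in> glued S (\<lambda>_ _. 1)" "\<alpha> * \<beta> \<in> glued S (\<lambda>_ _. 1)"
      using ideal_prod.prod[OF x \<beta>(1), of fun_ring] ideal_prod.prod[OF \<alpha>(1) \<beta>(1), of fun_ring]
        eval_on_glued AB by auto
    have "[x b = t b c * x c] (mod (c - b))" if bc: "b \<in> S" "c \<in> S" "b < c" for b c
    proof -
      let ?m = "c - b"
      have xb: "[x b * \<beta> b = x c * \<beta> c] (mod ?m)" and ab: "[\<alpha> b * \<beta> b = \<alpha> c * \<beta> c] (mod ?m)"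
        using in1 bc by (auto simp: glued_def)
      have "[(x b * \<beta> b) * (\<alpha> c * \<beta> c) = (x c * \<beta> c) * (\<alpha> b * \<beta> b)] (mod ?m)"
        by (rule cong_mult[OF xb cong_sym[OF ab]])
      then have "[(\<beta> b * \<beta> c) * (x b * \<alpha> c) = (\<beta> b * \<beta> c) * (\<alpha> b * x c)] (mod ?m)"
        by (simp add: mult_ac)
      moreover have "coprime (\<beta> b * \<beta> c) ?m" using coprime_diffs_imp[OF S _ bc] \<beta>(2) bc by auto
      ultimately have *: "[x b * \<alpha> c = \<alpha> b * x c] (mod ?m)" by (simp only: cong_mult_lcancel)
      have "[x b * 1 = x b * (\<alpha> c * \<gamma> c)] (mod ?m)"
        using mod1(1)[OF bc] by (intro cong_mult) (auto simp: cong_sym)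
      also have "x b * (\<alpha> c * \<gamma> c) = (x b * \<alpha> c) * \<gamma> c" by simp
      also have "[\<dots> = (\<alpha> b * x c) * \<gamma> c] (mod ?m)" by (rule cong_mult[OF * cong_refl])
      finally show ?thesis by (simp add: t_def mult_ac)
    qed
    then show "x \<in> glued S t" using x A by (auto simp: glued_def eval_module_def)
  qed
  moreover have "glued S t \<subseteq> A"
  proof -
    have part: "(\<lambda>c. if c \<in> T then ?N * z c else 0) \<in> A" if "finite T" "T \<subseteq> S" for T z
      using that
    proof (induction T)
      case empty
      obtain x where "x \<in> A" using ne by auto
      then have "eval_on S 0 * x \<in> A" by (intro eval_moduleD[OF A])
      also have "eval_on S 0 * x = (\<lambda>c. 0)" by (auto simp: eval_on_def)
      finally show ?case by simp
    next
      case (insert b T)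
      then obtain x where x: "x \<in> A" "x b = 1" using one by auto
      have "(\<lambda>c. ?N * (if c = b then z b else 0)) \<in> glued S (\<lambda>_ _. 1)"
        using insert.prems by (intro conductor_in_glued[OF S]) (auto simp: maximal_order_def)
      then obtain q where q: "(\<lambda>c. ?N * (if c = b then z b else 0)) = eval_on S q" using R by auto
      have "eval_on S q * x + (\<lambda>c. if c \<in> T then ?N * z c else 0) \<in> A"
        using insert x by (intro eval_moduleD[OF A]) auto
      also have "eval_on S q * x + (\<lambda>c. if c \<in> T then ?N * z c else 0)
        = (\<lambda>c. if c \<in> insert b T then ?N * z c else 0)"
        unfolding q[symmetric] using insert.hyps x by (auto simp: fun_eq_iff)
      finally show ?case .
    qed
    show ?thesis
    proof
      fix u assume u: "u \<in> glued S t"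
      have ul: "u \<in> maximal_order S" using u by (simp add: glued_def)
      have "\<gamma> * u \<in> glued S (\<lambda>_ _. 1)"
        using inverse_glued[OF S \<alpha>t \<gamma>(2) _ \<gamma>(1), of u "\<lambda>_ _. 1"] u by simp
      then obtain q where q: "\<gamma> * u = eval_on S q" using R by auto
      have "\<forall>c\<in>S. \<exists>w. 1 - \<alpha> c * \<gamma> c = ?N * w"
        using \<gamma>(2) by (metis cong_iff_dvd_diff cong_sym dvdE)
      then obtain w where w: "\<forall>c\<in>S. 1 - \<alpha> c * \<gamma> c = ?N * w c" by metis
      have "eval_on S q * \<alpha> + (\<lambda>c. if c \<in> S then ?N * (w c * u c) else 0) \<in> A"
        using S \<alpha> by (intro eval_moduleD[OF A] part) auto
      also have "eval_on S q * \<alpha> + (\<lambda>c. if c \<in> S then ?N * (w c * u c) else 0) = u"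
      proof
        fix c
        show "(eval_on S q * \<alpha> + (\<lambda>c. if c \<in> S then ?N * (w c * u c) else 0)) c = u c"
        proof (cases "c \<in> S")
          case True
          have "\<gamma> c * u c * \<alpha> c + ?N * (w c * u c) = (\<alpha> c * \<gamma> c + ?N * w c) * u c"
            by (simp add: algebra_simps)
          also have "\<alpha> c * \<gamma> c + ?N * w c = 1" using w True by auto
          finally show ?thesis using True by (simp flip: q)
        qed (use ul in \<open>auto simp: maximal_order_def eval_on_def\<close>)
      qed
      finally show "u \<in> A" .
    qed
  qed
  ultimately show ?thesis using unit by blast
qed

section \<open>Free abelian groups\<close>

lemma int_subgroup_generator:
  fixes H :: "int set"
  assumes add: "\<And>x y. x \<in> H \<Longrightarrow> y \<in> H \<Longrightarrow> x + y \<in> H" and scale: "\<And>k x. x \<in> H \<Longrightarrow> k * x \<in> H"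
    and ex: "h \<in> H" "h \<noteq> 0"
  shows "\<exists>g. g \<in> H \<and> g \<noteq> 0 \<and> (\<forall>x\<in>H. g dvd x)"
proof -
  obtain g where g: "g \<in> H" "g \<noteq> 0" and
    gmin: "\<And>x. x \<in> H \<Longrightarrow> x \<noteq> 0 \<Longrightarrow> nat \<bar>g\<bar> \<le> nat \<bar>x\<bar>"
    using exists_least_iff[of "\<lambda>k. \<exists>x. x \<in> H \<and> x \<noteq> 0 \<and> nat \<bar>x\<bar> = k"] ex
    by (metis not_less)
  have "g dvd x" if x: "x \<in> H" for x
  proof -
    have "x + - (x div g) * g \<in> H" by (intro add scale x g)
    then have "x mod g \<in> H" by (simp add: minus_div_mult_eq_mod)
    moreover have "\<bar>x mod g\<bar> < \<bar>g\<bar>" using g by (simp add: abs_mod_less)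
    ultimately have "x mod g = 0" using gmin[of "x mod g"] by linarith
    then show ?thesis by (simp add: mod_eq_0_iff_dvd)
  qed
  then show ?thesis using g by blast
qed

text \<open>A triangular basis: an element of \<open>A\<close> whose coordinate at \<open>c\<close> generates the projection of \<open>A\<close> to
  that coordinate, together with a basis of the elements that vanish at \<open>c\<close>.\<close>
lemma full_sublattice_free:
  assumes "finite S" "A \<subseteq> maximal_order S" "\<And>x y. x \<in> A \<Longrightarrow> y \<in> A \<Longrightarrow> x + y \<in> A"
    "\<And>k x. x \<in> A \<Longrightarrow> (\<lambda>d. k * x d) \<in> A" "N \<noteq> 0" "0 \<in> A"
    "\<And>c. c \<in> S \<Longrightarrow> (\<lambda>d. if d = c then N else 0) \<in> A"
  shows "\<exists>\<phi>. bij_betw \<phi> {p. Poly_Mapping.keys p \<subseteq> {..<card S}} A \<and>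
    (\<forall>p q. Poly_Mapping.keys p \<subseteq> {..<card S} \<longrightarrow> Poly_Mapping.keys q \<subseteq> {..<card S} \<longrightarrow> 
      \<phi> (p + q :: nat \<Rightarrow>\<^sub>0 int) = \<phi> p + \<phi> q)"
  using assms
proof (induction S arbitrary: A)
  case empty
  then have "A \<subseteq> {0}" by (auto simp: maximal_order_def fun_eq_iff)
  then have "A = {0}" using empty.prems(5) by blast
  then show ?case by (intro exI[of _ "\<lambda>_. 0"]) (auto simp: bij_betw_def)
next
  case (insert c S)
  let ?m = "card S"
  let ?F = "\<lambda>m. {p :: nat \<Rightarrow>\<^sub>0 int. Poly_Mapping.keys p \<subseteq> {..<m}}"
  note add = insert.prems(2) and scale = insert.prems(3) and zero = insert.prems(5)
  define H where "H = (\<lambda>x. x c) ` A"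
  have "\<exists>g. g \<in> H \<and> g \<noteq> 0 \<and> (\<forall>x\<in>H. g dvd x)"
  proof (rule int_subgroup_generator)
    show "x + y \<in> H" if "x \<in> H" "y \<in> H" for x y
    proof -
      obtain u v where uv: "u \<in> A" "v \<in> A" "x = u c" "y = v c"
        using \<open>x \<in> H\<close> \<open>y \<in> H\<close> unfolding H_def by (elim imageE)
      show ?thesis using imageI[OF add[OF uv(1,2)], of "\<lambda>x. x c"] by (simp add: H_def uv(3,4))
    qed
    show "k * x \<in> H" if "x \<in> H" for k x
    proof -
      obtain u where u: "u \<in> A" "x = u c" using \<open>x \<in> H\<close> unfolding H_def by (elim imageE)
      show ?thesis using imageI[OF scale[OF u(1)], of "\<lambda>x. x c" k] by (simp add: H_def u(2))
    qed
    have "(\<lambda>d. if d = c then N else 0) \<in> A" using insert.prems by simp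
    from imageI[OF this, of "\<lambda>x. x c"] show "N \<in> H" by (simp add: H_def)
    show "N \<noteq> 0" by (rule insert.prems(4))
  qed
  then obtain g where g: "g \<in> H" "g \<noteq> 0" "\<forall>x\<in>H. g dvd x" by blast
  obtain b where b: "b \<in> A" "b c = g" using g(1) unfolding H_def by (elim imageE) simp
  have bdvd: "b c dvd x c" if "x \<in> A" for x
    using g(3) that by (simp add: H_def b(2))
  have "b c \<noteq> 0" using b(2) g(2) by simp
  note b = b(1) this
  define A' where "A' = {u \<in> A. u c = 0}"
  have "\<exists>\<phi>. bij_betw \<phi> (?F ?m) A' \<and> (\<forall>p q. Poly_Mapping.keys p \<subseteq> {..<?m} \<longrightarrow> Poly_Mapping.keys q \<subseteq> {..<?m} \<longrightarrow> 
      \<phi> (p + q) = \<phi> p + \<phi> q)"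
  proof (rule insert.IH)
    show "A' \<subseteq> maximal_order S" using insert.prems(1) by (auto simp: A'_def maximal_order_def)
  qed (use insert.prems insert.hyps in \<open>auto simp: A'_def\<close>)
  then obtain \<phi> where \<phi>: "bij_betw \<phi> (?F ?m) A'" 
    "\<And>p q. p \<in> ?F ?m \<Longrightarrow> q \<in> ?F ?m \<Longrightarrow> \<phi> (p + q) = \<phi> p + \<phi> q" by auto
  \<comment> \<open>The basis element with index \<open>card S\<close> is \<open>b\<close>; \<open>cut\<close> removes its coefficient.\<close>
  define cut where "cut p = p - Poly_Mapping.single ?m (Poly_Mapping.lookup p ?m)" for p :: "nat \<Rightarrow>\<^sub>0 int"
  define \<psi> where "\<psi> p = \<phi> (cut p) + (\<lambda>d. Poly_Mapping.lookup p ?m * b d)" for p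
  have cutF: "cut p \<in> ?F ?m" if "p \<in> ?F (Suc ?m)" for p
  proof -
    have "Poly_Mapping.lookup (cut p) i = (if i = ?m then 0 else Poly_Mapping.lookup p i)" for i
      by (simp add: cut_def lookup_minus lookup_single when_def)
    then show ?thesis using that by (auto simp: in_keys_iff subset_iff less_Suc_eq split: if_splits)
  qed
  have \<phi>A: "\<phi> p \<in> A" "\<phi> p c = 0" if "p \<in> ?F ?m" for p
    using bij_betwE[OF \<phi>(1)] that by (auto simp: A'_def)
  have \<psi>c: "\<psi> p c = Poly_Mapping.lookup p ?m * b c" if "p \<in> ?F (Suc ?m)" for p
    using \<phi>A(2)[OF cutF[OF that]] by (simp add: \<psi>_def)
  have "bij_betw \<psi> (?F (Suc ?m)) A"
    unfolding bij_betw_def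
  proof (intro conjI inj_onI subset_antisym subsetI)
    fix p q assume p: "p \<in> ?F (Suc ?m)" and q: "q \<in> ?F (Suc ?m)" and eq: "\<psi> p = \<psi> q"
    have l: "Poly_Mapping.lookup p ?m = Poly_Mapping.lookup q ?m"
      using \<psi>c[OF p] \<psi>c[OF q] eq b by simp
    then have "\<phi> (cut p) = \<phi> (cut q)" using eq by (simp add: \<psi>_def)
    then have "cut p = cut q" using inj_onD[OF bij_betw_imp_inj_on[OF \<phi>(1)]] cutF[OF p] cutF[OF q] by blast
    then show "p = q" using l by (simp add: cut_def)
  next
    fix u assume "u \<in> \<psi> ` ?F (Suc ?m)"
    then show "u \<in> A" using cutF \<phi>A b by (auto simp: \<psi>_def intro!: add scale)
  next
    fix u assume u: "u \<in> A"
    obtain k where k: "u c = b c * k" using bdvd[OF u] by blast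
    have "u + (\<lambda>d. - k * b d) \<in> A" by (intro add scale u b)
    then have "u + (\<lambda>d. - k * b d) \<in> A'" using k by (simp add: A'_def)
    then obtain p where p: "p \<in> ?F ?m" "\<phi> p = u + (\<lambda>d. - k * b d)"
      using \<phi>(1) by (metis (no_types, lifting) bij_betw_def imageE)
    define q where "q = p + Poly_Mapping.single ?m k"
    have "Poly_Mapping.lookup p ?m = 0" using p(1) by (auto simp: in_keys_iff subset_iff)
    then have lq: "Poly_Mapping.lookup q ?m = k" by (simp add: q_def lookup_add)
    then have "cut q = p" by (simp add: cut_def q_def)
    then have "\<psi> q = u" using p lq by (auto simp: \<psi>_def)
    moreover have "q \<in> ?F (Suc ?m)"
      using p(1) keys_add[of p "Poly_Mapping.single ?m k"] by (fastforce simp: q_def split: if_splits)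
    ultimately show "u \<in> \<psi> ` ?F (Suc ?m)" by blast
  qed
  moreover have "\<psi> (p + q) = \<psi> p + \<psi> q" if "p \<in> ?F (Suc ?m)" "q \<in> ?F (Suc ?m)" for p q
  proof -
    have "cut (p + q) = cut p + cut q" by (simp add: cut_def lookup_add single_add)
    then show ?thesis using \<phi>(2)[OF cutF[OF that(1)] cutF[OF that(2)]]
      by (auto simp: \<psi>_def lookup_add algebra_simps fun_eq_iff)
  qed
  ultimately show ?case using insert.hyps by auto
qed

lemma glued_free:
  assumes S: "finite S"
  shows "\<exists>\<phi>. bij_betw \<phi> (carrier (free_Abelian_group {..<card S})) (glued S t) \<and>
    (\<forall>p\<in>carrier (free_Abelian_group {..<card S}). \<forall>q\<in>carrier (free_Abelian_group {..<card S}). 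
      \<phi> (p + q) = \<phi> p + \<phi> q)"
proof -
  have M: "eval_module S (glued S t)" by (rule eval_module_glued)
  have "\<exists>\<phi>. bij_betw \<phi> {p. Poly_Mapping.keys p \<subseteq> {..<card S}} (glued S t) \<and>
    (\<forall>p q. Poly_Mapping.keys p \<subseteq> {..<card S} \<longrightarrow> Poly_Mapping.keys q \<subseteq> {..<card S} \<longrightarrow> 
      \<phi> (p + q :: nat \<Rightarrow>\<^sub>0 int) = \<phi> p + \<phi> q)"
  proof (rule full_sublattice_free[where N = "diffs S"])
    fix k x assume x: "x \<in> glued S t"
    have "eval_on S [:k:] * x \<in> glued S t" using eval_moduleD(3)[OF M x] .
    also have "eval_on S [:k:] * x = (\<lambda>d. k * x d)"
      using x by (auto simp: eval_on_def glued_def maximal_order_def fun_eq_iff)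
    finally show "(\<lambda>d. k * x d) \<in> glued S t" .
  next
    fix c assume c: "c \<in> S"
    have "(\<lambda>d. diffs S * (if d = c then 1 else 0)) \<in> glued S t"
      using c by (intro conductor_in_glued S) (auto simp: maximal_order_def)
    then show "(\<lambda>d. if d = c then diffs S else 0) \<in> glued S t" by (simp add: if_distrib cong: if_cong)
  qed (use S diffs_nonzero eval_moduleD[OF M] in \<open>auto simp: glued_def maximal_order_def\<close>)
  then show ?thesis by (simp add: free_Abelian_group_def)
qed

section \<open>Coordinates on the algebra\<close>

text \<open>The class of \<open>p\<close> modulo \<open>f\<close>, described by divisibility; \<open>coset_eq_residue\<close> identifies it with the
  coset of the principal ideal.\<close>
definition residue :: "'a :: comm_ring_1 poly \<Rightarrow> 'a poly \<Rightarrow> 'a poly set" where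
  "residue f p = {q. f dvd q - p}"

lemma residue_eq_iff: "residue f p = residue f q \<longleftrightarrow> f dvd p - q"
proof
  assume "residue f p = residue f q"
  then have "p \<in> residue f q" by (auto simp: residue_def)
  then show "f dvd p - q" by (simp add: residue_def)
next
  assume *: "f dvd p - q"
  have "f dvd r - p \<longleftrightarrow> f dvd r - q" for r
    using dvd_add_left_iff[OF *, of "r - p"] by simp
  then show "residue f p = residue f q" by (simp add: residue_def)
qed

lemma cgenideal_eq_multiples:
  "PIdl\<^bsub>ring_of_type_algebra\<^esub> (f :: 'a :: comm_ring_1) = {g. f dvd g}"
  by (auto simp: cgenideal_def dvd_def mult.commute)

lemma ideal_cgenideal: "ideal (PIdl\<^bsub>ring_of_type_algebra\<^esub> (f :: 'a :: comm_ring_1)) ring_of_type_algebra"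
  using cring.cgenideal_ideal[OF cring_from_type_algebra] by simp

lemma coset_eq_residue:
  "PIdl\<^bsub>ring_of_type_algebra\<^esub> f +>\<^bsub>ring_of_type_algebra\<^esub> p = residue f p"
  unfolding cgenideal_eq_multiples residue_def a_r_coset_def'
proof (intro equalityI subsetI)
  fix q assume "q \<in> {q. f dvd q - p}"
  then show "q \<in> (\<Union>h\<in>{g. f dvd g}. {h \<oplus>\<^bsub>ring_of_type_algebra\<^esub> p})"
    by (auto intro!: exI[of _ "q - p"])
qed auto

lemma quotient_by_poly:
  fixes f :: "'a :: comm_ring_1 poly"
  defines "Q \<equiv> ring_of_type_algebra Quot PIdl\<^bsub>ring_of_type_algebra\<^esub> f"
  shows "cring Q" "carrier Q = range (residue f)"
    "residue f p \<otimes>\<^bsub>Q\<^esub> residue f q = residue f (p * q)"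
    "residue f p \<oplus>\<^bsub>Q\<^esub> residue f q = residue f (p + q)"
    "\<one>\<^bsub>Q\<^esub> = residue f 1" "\<zero>\<^bsub>Q\<^esub> = residue f 0"
proof -
  interpret ideal "PIdl\<^bsub>ring_of_type_algebra\<^esub> f" ring_of_type_algebra by (rule ideal_cgenideal)
  show "cring Q" unfolding Q_def by (rule quotient_is_cring) (rule cring_from_type_algebra)
  show "carrier Q = range (residue f)"
    by (simp add: Q_def FactRing_def A_RCOSETS_def' coset_eq_residue full_SetCompr_eq UNION_singleton_eq_range)
  show "residue f p \<otimes>\<^bsub>Q\<^esub> residue f q = residue f (p * q)"
    using rcoset_mult_add[of p q] by (simp add: Q_def FactRing_def coset_eq_residue)
  show "residue f p \<oplus>\<^bsub>Q\<^esub> residue f q = residue f (p + q)"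
    using a_rcos_sum[of p q] by (simp add: Q_def FactRing_def coset_eq_residue)
  show "\<one>\<^bsub>Q\<^esub> = residue f 1"
    by (simp add: Q_def FactRing_def coset_eq_residue)
  show "\<zero>\<^bsub>Q\<^esub> = residue f 0"
    by (simp add: Q_def FactRing_def cgenideal_eq_multiples residue_def)
qed

lemma K_alg_simps [simp]:
  "carrier (K_alg f) = carrier (K_ring f)" "monoid.mult (K_alg f) = monoid.mult (K_ring f)"
  "ring.add (K_alg f) = ring.add (K_ring f)" "\<one>\<^bsub>K_alg f\<^esub> = \<one>\<^bsub>K_ring f\<^esub>"
  "\<zero>\<^bsub>K_alg f\<^esub> = \<zero>\<^bsub>K_ring f\<^esub>" "r \<odot>\<^bsub>K_alg f\<^esub> x = to_K f r \<otimes>\<^bsub>K_ring f\<^esub> x"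
  by (simp_all add: K_alg_def ring.defs module.defs)

lemma cring_K_alg: "cring (K_alg f)"
proof -
  interpret K: cring "K_ring f" unfolding K_ring_def by (rule quotient_by_poly)
  show ?thesis
  proof (rule cringI)
    show "abelian_group (K_alg f)"
      by (rule abelian_groupI) (auto simp: K.a_ac intro: K.l_neg exI[of _ "\<ominus>\<^bsub>K_ring f\<^esub> _"])
    show "Group.comm_monoid (K_alg f)"
      by (rule comm_monoidI) (auto simp: K.m_ac)
  qed (auto simp: K.l_distr)
qed

lemma map_poly_of_int_mult:
  "map_poly of_int (p * q) = (map_poly of_int p * map_poly of_int q :: 'a :: comm_ring_1 poly)"
  by (intro poly_eqI) (simp add: coeff_map_poly coeff_mult)

lemma map_poly_of_int_diff:
  "map_poly of_int (p - q) = (map_poly of_int p - map_poly of_int q :: 'a :: comm_ring_1 poly)"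
  by (intro poly_eqI) (simp add: coeff_map_poly)

lemma poly_map_of_int:
  "poly (map_poly of_int p :: 'a :: comm_ring_1 poly) (of_int c) = of_int (poly p c)"
  by (induction p) (auto simp: map_poly_pCons)

definition split_poly :: "int set \<Rightarrow> int poly" where
  "split_poly S = (\<Prod>c\<in>S. [:- c, 1:])"

lemma degree_split_poly: "finite S \<Longrightarrow> Polynomial.degree (split_poly S) = card S"
  unfolding split_poly_def by (subst degree_prod_eq_sum_degree) auto

lemma split_poly_dvd_iff:
  assumes "finite S"
  shows "map_poly of_int (split_poly S) dvd (p :: rat poly) \<longleftrightarrow> (\<forall>c\<in>S. poly p (of_int c) = 0)"
  using assms
proof (induction S arbitrary: p)
  case empty then show ?case by (simp add: split_poly_def)
next
  case (insert c S)
  let ?F = "\<lambda>S. map_poly of_int (split_poly S) :: rat poly"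
  have F: "?F (insert c S) = [:- of_int c, 1:] * ?F S"
    using insert.hyps by (simp add: split_poly_def map_poly_of_int_mult map_poly_pCons del: mult_pCons_left)
  have Fc: "poly (?F S) (of_int c) \<noteq> 0"
    using insert.hyps by (auto simp: poly_map_of_int split_poly_def poly_prod)
  show ?case
  proof
    assume *: "?F (insert c S) dvd p"
    then have "?F S dvd p" "[:- of_int c, 1:] dvd p" unfolding F by (metis dvd_mult_left dvd_mult_right)+
    then show "\<forall>c\<in>insert c S. poly p (of_int c) = 0"
      using insert.IH by (auto simp: poly_eq_0_iff_dvd)
  next
    assume *: "\<forall>c\<in>insert c S. poly p (of_int c) = 0"
    then have "?F S dvd p" using insert.IH by simp
    then obtain q where q: "p = ?F S * q" by (rule dvdE)
    then have "poly q (of_int c) = 0" using * Fc by auto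
    then have "[:- of_int c, 1:] dvd q" by (simp add: poly_eq_0_iff_dvd)
    then show "?F (insert c S) dvd p" unfolding F q by (metis dvd_refl mult.commute mult_dvd_mono)
  qed
qed

lemma exists_interpolating_poly:
  assumes "finite S"
  shows "\<exists>p :: rat poly. \<forall>c\<in>S. poly p (of_int c) = u c"
  using assms
proof (induction S)
  case (insert c S)
  then obtain p :: "rat poly" where p: "\<forall>c\<in>S. poly p (of_int c) = u c" by auto
  define F where "F = (map_poly of_int (split_poly S) :: rat poly)"
  have "poly F (of_int c) \<noteq> 0" "\<forall>d\<in>S. poly F (of_int d) = 0"
    using insert.hyps by (auto simp: F_def poly_map_of_int split_poly_def poly_prod)
  then show ?case using p
    by (intro exI[of _ "p + Polynomial.smult ((u c - poly p (of_int c)) / poly F (of_int c)) F"]) auto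
qed auto

text \<open>The element of \<open>K\<close> with coordinates \<open>u\<close> at the roots.  Values of \<open>u\<close> outside \<open>S\<close> are ignored, so
  \<open>elt S\<close> is a surjective ring homomorphism from all functions \<open>int \<Rightarrow> rat\<close> with pointwise operations.\<close>
definition elt :: "int set \<Rightarrow> (int \<Rightarrow> rat) \<Rightarrow> rat poly set" where
  "elt S u = residue (map_poly of_int (split_poly S)) (SOME p. \<forall>c\<in>S. poly p (of_int c) = u c)"

definition int_elt :: "int set \<Rightarrow> (int \<Rightarrow> int) \<Rightarrow> rat poly set" where
  "int_elt S u = elt S (\<lambda>c. of_int (u c))"

lemma residue_eq_elt:
  assumes "finite S" "\<forall>c\<in>S. poly p (of_int c) = u c"
  shows "residue (map_poly of_int (split_poly S)) p = elt S u"
proof -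
  have "\<forall>c\<in>S. poly (SOME p. \<forall>c\<in>S. poly p (of_int c) = u c) (of_int c) = u c"
    using exists_interpolating_poly[OF assms(1)] by (rule someI_ex)
  then show ?thesis
    using assms by (simp add: elt_def residue_eq_iff split_poly_dvd_iff)
qed

locale finite_roots =
  fixes S :: "int set"
  assumes finite_S: "finite S"
begin

abbreviation "K \<equiv> K_alg (split_poly S)"

sublocale K: cring K by (rule cring_K_alg)

lemma ex_residue_eq_elt:
  obtains p where "\<forall>c\<in>S. poly p (of_int c) = u c" "elt S u = residue (map_poly of_int (split_poly S)) p"
  using exists_interpolating_poly[OF finite_S, of u] residue_eq_elt[OF finite_S] by metis

lemma carrier_K: "carrier K = range (elt S)"
proof -
  have "residue (map_poly of_int (split_poly S)) p \<in> range (elt S)" for p :: "rat poly"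
    using residue_eq_elt[OF finite_S, of p "\<lambda>c. poly p (of_int c)"] by auto
  then show ?thesis
    by (auto simp: K_ring_def quotient_by_poly(2) elt_def)
qed

lemma elt_in_carrier: "elt S u \<in> carrier K"
  unfolding carrier_K by blast

lemma elt_eq_iff: "elt S u = elt S v \<longleftrightarrow> (\<forall>c\<in>S. u c = v c)"
proof -
  obtain p q where p: "\<forall>c\<in>S. poly p (of_int c) = u c" "elt S u = residue (map_poly of_int (split_poly S)) p"
    and q: "\<forall>c\<in>S. poly q (of_int c) = v c" "elt S v = residue (map_poly of_int (split_poly S)) q"
    by (metis ex_residue_eq_elt)
  show ?thesis unfolding p(2) q(2) residue_eq_iff split_poly_dvd_iff[OF finite_S] using p(1) q(1) by auto
qed

lemma elt_mult: "elt S u \<otimes>\<^bsub>K\<^esub> elt S v = elt S (u * v)"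
proof -
  obtain p q where p: "\<forall>c\<in>S. poly p (of_int c) = u c" "elt S u = residue (map_poly of_int (split_poly S)) p"
    and q: "\<forall>c\<in>S. poly q (of_int c) = v c" "elt S v = residue (map_poly of_int (split_poly S)) q"
    by (metis ex_residue_eq_elt)
  show ?thesis unfolding p(2) q(2) using p(1) q(1)
    by (simp add: K_ring_def quotient_by_poly(3)) (rule residue_eq_elt[OF finite_S], auto)
qed

lemma elt_add: "elt S u \<oplus>\<^bsub>K\<^esub> elt S v = elt S (u + v)"
proof -
  obtain p q where p: "\<forall>c\<in>S. poly p (of_int c) = u c" "elt S u = residue (map_poly of_int (split_poly S)) p"
    and q: "\<forall>c\<in>S. poly q (of_int c) = v c" "elt S v = residue (map_poly of_int (split_poly S)) q"
    by (metis ex_residue_eq_elt)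
  show ?thesis unfolding p(2) q(2) using p(1) q(1)
    by (simp add: K_ring_def quotient_by_poly(4)) (rule residue_eq_elt[OF finite_S], auto)
qed

lemma elt_one: "\<one>\<^bsub>K\<^esub> = elt S 1"
  by (simp add: K_ring_def quotient_by_poly(5)) (rule residue_eq_elt[OF finite_S], auto)

lemma elt_zero: "\<zero>\<^bsub>K\<^esub> = elt S 0"
  by (simp add: K_ring_def quotient_by_poly(6)) (rule residue_eq_elt[OF finite_S], auto)

lemma elt_Units_iff: "elt S u \<in> Units K \<longleftrightarrow> (\<forall>c\<in>S. u c \<noteq> 0)"
proof
  assume "elt S u \<in> Units K"
  then obtain v where "elt S u \<otimes>\<^bsub>K\<^esub> elt S v = \<one>\<^bsub>K\<^esub>"
    unfolding Units_def carrier_K by auto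
  then have "\<forall>c\<in>S. u c * v c = 1" by (simp only: elt_mult elt_one elt_eq_iff) simp
  then show "\<forall>c\<in>S. u c \<noteq> 0" by auto
next
  assume *: "\<forall>c\<in>S. u c \<noteq> 0"
  have "elt S u \<otimes>\<^bsub>K\<^esub> elt S (\<lambda>c. 1 / u c) = \<one>\<^bsub>K\<^esub>" "elt S (\<lambda>c. 1 / u c) \<otimes>\<^bsub>K\<^esub> elt S u = \<one>\<^bsub>K\<^esub>"
    using * by (simp_all only: elt_mult elt_one elt_eq_iff) simp_all
  then show "elt S u \<in> Units K"
    unfolding Units_def using elt_in_carrier by blast
qed

lemma int_elt_mult: "int_elt S u \<otimes>\<^bsub>K\<^esub> int_elt S v = int_elt S (u * v)"
  unfolding int_elt_def elt_mult by (simp add: elt_eq_iff)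

lemma int_elt_add: "int_elt S u \<oplus>\<^bsub>K\<^esub> int_elt S v = int_elt S (u + v)"
  unfolding int_elt_def elt_add by (simp add: elt_eq_iff)

lemma int_elt_in_carrier: "int_elt S u \<in> carrier K"
  unfolding int_elt_def by (rule elt_in_carrier)

lemma int_elt_inj: "inj_on (int_elt S) (maximal_order S)"
  by (rule inj_onI) (auto simp: int_elt_def elt_eq_iff maximal_order_def fun_eq_iff)

text \<open>This and \<open>unit_ideal_eq\<close> reduce statements about ideals inside \<open>\<int>\<^sup>S\<close> to integer vectors.\<close>
lemma ideal_prod_int_elt:
  "ideal_prod K (int_elt S ` A) (int_elt S ` B) = int_elt S ` ideal_prod fun_ring A B"
proof
  show "ideal_prod K (int_elt S ` A) (int_elt S ` B) \<subseteq> int_elt S ` ideal_prod fun_ring A B"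
  proof (rule ideal_prod_mono)
    fix x y assume "x \<in> int_elt S ` A" "y \<in> int_elt S ` B"
    then obtain u v where "u \<in> A" "v \<in> B" "x \<otimes>\<^bsub>K\<^esub> y = int_elt S (u * v)" using int_elt_mult by auto
    then show "x \<otimes>\<^bsub>K\<^esub> y \<in> int_elt S ` ideal_prod fun_ring A B"
      using ideal_prod.prod[of u A v B fun_ring] by auto
  next
    fix x y assume "x \<in> int_elt S ` ideal_prod fun_ring A B" "y \<in> int_elt S ` ideal_prod fun_ring A B"
    then obtain u v where "u \<in> ideal_prod fun_ring A B" "v \<in> ideal_prod fun_ring A B"
      "x \<oplus>\<^bsub>K\<^esub> y = int_elt S (u + v)" using int_elt_add by auto
    then show "x \<oplus>\<^bsub>K\<^esub> y \<in> int_elt S ` ideal_prod fun_ring A B"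
      using ideal_prod.sum[of u fun_ring A B v] by auto
  qed
  have "int_elt S z \<in> ideal_prod K (int_elt S ` A) (int_elt S ` B)" if "z \<in> ideal_prod fun_ring A B" for z
    using that
  proof induction
    case (prod u v)
    then show ?case
      using ideal_prod.prod[of "int_elt S u" "int_elt S ` A" "int_elt S v" "int_elt S ` B" K]
      unfolding int_elt_mult by (simp add: times_fun_def)
  next
    case (sum u v)
    then show ?case
      using ideal_prod.sum[of "int_elt S u" K "int_elt S ` A" "int_elt S ` B" "int_elt S v"]
      unfolding int_elt_add by (simp add: plus_fun_def)
  qed
  then show "int_elt S ` ideal_prod fun_ring A B \<subseteq> ideal_prod K (int_elt S ` A) (int_elt S ` B)" by blast
qed

lemma to_K_residue:
  "to_K (split_poly S) (residue (split_poly S) p) = int_elt S (eval_on S p)"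
proof -
  let ?F = "map_poly rat_of_int (split_poly S)"
  have "residue ?F (map_poly of_int q) = residue ?F (map_poly of_int p)"
    if "q \<in> residue (split_poly S) p" for q
  proof -
    have "?F dvd map_poly of_int (q - p)"
      using that unfolding residue_def by (auto simp: dvd_def map_poly_of_int_mult)
    then show ?thesis by (simp add: residue_eq_iff map_poly_of_int_diff)
  qed
  moreover have "p \<in> residue (split_poly S) p" by (simp add: residue_def)
  ultimately have "to_K (split_poly S) (residue (split_poly S) p) = residue ?F (map_poly of_int p)"
    unfolding to_K_def coset_eq_residue by blast
  also have "\<dots> = int_elt S (eval_on S p)"
    unfolding int_elt_def by (rule residue_eq_elt[OF finite_S]) (simp add: poly_map_of_int eval_on_def)
  finally show ?thesis .
qed

lemma carrier_order_ring: "carrier (order_ring (split_poly S)) = range (residue (split_poly S))"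
  by (simp add: order_ring_def quotient_by_poly(2))

lemma unit_ideal_eq: "unit_ideal (split_poly S) = int_elt S ` range (eval_on S)"
  unfolding unit_ideal_def carrier_order_ring by (simp add: image_image to_K_residue)

lemma submodule_iff:
  "submodule I (order_ring (split_poly S)) K \<longleftrightarrow> subgroup I (add_monoid K) \<and>
     (\<forall>p. \<forall>x\<in>I. int_elt S (eval_on S p) \<otimes>\<^bsub>K\<^esub> x \<in> I)"
  unfolding submodule_def submodule_axioms_def carrier_order_ring by (simp flip: to_K_residue) blast

end

section \<open>Fractional ideals and their classes\<close>

context finite_roots
begin

lemma l_coset_eq_image: "k <#\<^bsub>K\<^esub> J = (\<lambda>x. k \<otimes>\<^bsub>K\<^esub> x) ` J"
  by (auto simp: l_coset_def)

lemma l_coset_assoc: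
  assumes "k \<in> carrier K" "l \<in> carrier K" "J \<subseteq> carrier K"
  shows "k <#\<^bsub>K\<^esub> (l <#\<^bsub>K\<^esub> J) = (k \<otimes>\<^bsub>K\<^esub> l) <#\<^bsub>K\<^esub> J"
  unfolding l_coset_eq_image image_image using assms K.m_assoc by (intro image_cong) auto

lemma l_coset_one: "J \<subseteq> carrier K \<Longrightarrow> \<one>\<^bsub>K\<^esub> <#\<^bsub>K\<^esub> J = J"
  unfolding l_coset_eq_image using K.l_one by (force simp del: K_alg_simps)

lemma fractional_ideal_iff:
  "fractional_ideal (split_poly S) I \<longleftrightarrow> subgroup I (add_monoid K) \<and>
     (\<forall>p. \<forall>x\<in>I. int_elt S (eval_on S p) \<otimes>\<^bsub>K\<^esub> x \<in> I) \<and>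
     (add_monoid K)\<lparr>carrier := I\<rparr> \<cong> free_Abelian_group {..<card S}"
  unfolding fractional_ideal_def submodule_iff degree_split_poly[OF finite_S] by blast

lemma fractional_idealD:
  assumes "fractional_ideal (split_poly S) I"
  shows "I \<subseteq> carrier K" "\<zero>\<^bsub>K\<^esub> \<in> I" "\<And>x y. x \<in> I \<Longrightarrow> y \<in> I \<Longrightarrow> x \<oplus>\<^bsub>K\<^esub> y \<in> I"
    "\<And>x. x \<in> I \<Longrightarrow> \<ominus>\<^bsub>K\<^esub> x \<in> I" "\<And>p x. x \<in> I \<Longrightarrow> int_elt S (eval_on S p) \<otimes>\<^bsub>K\<^esub> x \<in> I"
proof -
  have I: "subgroup I (add_monoid K)" using assms unfolding fractional_ideal_iff by blast
  show "I \<subseteq> carrier K" "\<zero>\<^bsub>K\<^esub> \<in> I" "\<And>x y. x \<in> I \<Longrightarrow> y \<in> I \<Longrightarrow> x \<oplus>\<^bsub>K\<^esub> y \<in> I"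
    using subgroup.subset[OF I] subgroup.one_closed[OF I] subgroup.m_closed[OF I]
    by (simp_all del: K_alg_simps)
  show "\<And>x. x \<in> I \<Longrightarrow> \<ominus>\<^bsub>K\<^esub> x \<in> I"
    using subgroup.m_inv_closed[OF I] unfolding a_inv_def .
  show "\<And>p x. x \<in> I \<Longrightarrow> int_elt S (eval_on S p) \<otimes>\<^bsub>K\<^esub> x \<in> I"
    using assms unfolding fractional_ideal_iff by blast
qed

lemma subgroup_add_monoidI:
  assumes "I \<subseteq> carrier K" "I \<noteq> {}" "\<And>x. x \<in> I \<Longrightarrow> \<ominus>\<^bsub>K\<^esub> x \<in> I"
    "\<And>x y. x \<in> I \<Longrightarrow> y \<in> I \<Longrightarrow> x \<oplus>\<^bsub>K\<^esub> y \<in> I"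
  shows "subgroup I (add_monoid K)"
  by (rule group.subgroupI[OF K.a_group])
     (use assms in \<open>simp_all add: a_inv_def[symmetric] del: K_alg_simps\<close>)

text \<open>Multiplication by a unit is an isomorphism of the underlying groups, so freeness of rank \<open>n\<close> is
  preserved.\<close>
lemma fractional_ideal_scale:
  assumes I: "fractional_ideal (split_poly S) I" and k: "k \<in> Units K"
  shows "fractional_ideal (split_poly S) (k <#\<^bsub>K\<^esub> I)"
proof -
  note D = fractional_idealD[OF I]
  let ?l = "inv\<^bsub>K\<^esub> k"
  have kc: "k \<in> carrier K" "?l \<in> carrier K" "?l \<otimes>\<^bsub>K\<^esub> k = \<one>\<^bsub>K\<^esub>"
    using k K.Units_closed K.Units_inv_closed K.Units_l_inv by blast+
  have lk: "?l \<otimes>\<^bsub>K\<^esub> (k \<otimes>\<^bsub>K\<^esub> x) = x" if "x \<in> I" for x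
  proof -
    have x: "x \<in> carrier K" using D(1) that by blast
    have "?l \<otimes>\<^bsub>K\<^esub> (k \<otimes>\<^bsub>K\<^esub> x) = (?l \<otimes>\<^bsub>K\<^esub> k) \<otimes>\<^bsub>K\<^esub> x" using K.m_assoc[OF kc(2,1) x] by (rule sym)
    also have "\<dots> = x" unfolding kc(3) by (rule K.l_one[OF x])
    finally show ?thesis .
  qed
  have "subgroup (k <#\<^bsub>K\<^esub> I) (add_monoid K)"
  proof (rule subgroup_add_monoidI)
    fix x assume "x \<in> k <#\<^bsub>K\<^esub> I"
    then obtain u where u: "u \<in> I" "x = k \<otimes>\<^bsub>K\<^esub> u" unfolding l_coset_eq_image by blast
    then have "\<ominus>\<^bsub>K\<^esub> x = k \<otimes>\<^bsub>K\<^esub> (\<ominus>\<^bsub>K\<^esub> u)" using K.r_minus kc D(1) by blast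
    then show "\<ominus>\<^bsub>K\<^esub> x \<in> k <#\<^bsub>K\<^esub> I" using D(4) u unfolding l_coset_eq_image by blast
  next
    fix x y assume "x \<in> k <#\<^bsub>K\<^esub> I" "y \<in> k <#\<^bsub>K\<^esub> I"
    then obtain u v where u: "u \<in> I" "x = k \<otimes>\<^bsub>K\<^esub> u" and v: "v \<in> I" "y = k \<otimes>\<^bsub>K\<^esub> v"
      unfolding l_coset_eq_image by blast
    then have "x \<oplus>\<^bsub>K\<^esub> y = k \<otimes>\<^bsub>K\<^esub> (u \<oplus>\<^bsub>K\<^esub> v)" using K.r_distr kc D(1) by blast
    then show "x \<oplus>\<^bsub>K\<^esub> y \<in> k <#\<^bsub>K\<^esub> I" using D(3) u v unfolding l_coset_eq_image by blast
  qed (use D kc K.m_closed in \<open>unfold l_coset_eq_image, blast+\<close>)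
  moreover have "int_elt S (eval_on S p) \<otimes>\<^bsub>K\<^esub> x \<in> k <#\<^bsub>K\<^esub> I" if x: "x \<in> k <#\<^bsub>K\<^esub> I" for p x
  proof -
    obtain u where u: "u \<in> I" "x = k \<otimes>\<^bsub>K\<^esub> u" using x unfolding l_coset_eq_image by blast
    have "int_elt S (eval_on S p) \<otimes>\<^bsub>K\<^esub> x = k \<otimes>\<^bsub>K\<^esub> (int_elt S (eval_on S p) \<otimes>\<^bsub>K\<^esub> u)"
      unfolding u(2) using K.m_lcomm int_elt_in_carrier kc D(1) u(1) by blast
    then show ?thesis using D(5) u unfolding l_coset_eq_image by blast
  qed
  moreover have "(add_monoid K)\<lparr>carrier := k <#\<^bsub>K\<^esub> I\<rparr> \<cong> free_Abelian_group {..<card S}"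
  proof (rule iso_trans)
    have "(\<lambda>x. ?l \<otimes>\<^bsub>K\<^esub> x) \<in> iso ((add_monoid K)\<lparr>carrier := k <#\<^bsub>K\<^esub> I\<rparr>) ((add_monoid K)\<lparr>carrier := I\<rparr>)"
    proof (rule isoI[OF homI])
      fix x y assume "x \<in> carrier ((add_monoid K)\<lparr>carrier := k <#\<^bsub>K\<^esub> I\<rparr>)"
        "y \<in> carrier ((add_monoid K)\<lparr>carrier := k <#\<^bsub>K\<^esub> I\<rparr>)"
      then have "x \<in> carrier K" "y \<in> carrier K"
        unfolding l_coset_eq_image using kc D(1) K.m_closed by (auto simp del: K_alg_simps)
      then show "?l \<otimes>\<^bsub>K\<^esub> (x \<otimes>\<^bsub>(add_monoid K)\<lparr>carrier := k <#\<^bsub>K\<^esub> I\<rparr>\<^esub> y)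
        = (?l \<otimes>\<^bsub>K\<^esub> x) \<otimes>\<^bsub>(add_monoid K)\<lparr>carrier := I\<rparr>\<^esub> (?l \<otimes>\<^bsub>K\<^esub> y)"
        using K.r_distr[of x y ?l] kc by (simp del: K_alg_simps)
    next
      show "bij_betw (\<lambda>x. ?l \<otimes>\<^bsub>K\<^esub> x) (carrier ((add_monoid K)\<lparr>carrier := k <#\<^bsub>K\<^esub> I\<rparr>))
        (carrier ((add_monoid K)\<lparr>carrier := I\<rparr>))"
        by (rule bij_betwI[where g = "\<lambda>x. k \<otimes>\<^bsub>K\<^esub> x"])
           (use lk in \<open>auto simp: l_coset_eq_image simp del: K_alg_simps\<close>)
    qed (use lk in \<open>auto simp: l_coset_eq_image simp del: K_alg_simps\<close>)
    then show "(add_monoid K)\<lparr>carrier := k <#\<^bsub>K\<^esub> I\<rparr> \<cong> (add_monoid K)\<lparr>carrier := I\<rparr>"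
      unfolding is_iso_def by blast
    show "(add_monoid K)\<lparr>carrier := I\<rparr> \<cong> free_Abelian_group {..<card S}"
      using I unfolding fractional_ideal_iff by blast
  qed
  ultimately show ?thesis unfolding fractional_ideal_iff by blast
qed

abbreviation glued_ideal :: "(int \<Rightarrow> int \<Rightarrow> int) \<Rightarrow> rat poly set set" where
  "glued_ideal t \<equiv> int_elt S ` glued S t"

lemma minus_int_elt: "\<ominus>\<^bsub>K\<^esub> int_elt S u = int_elt S (- u)"
  by (rule K.minus_equality)
     (simp_all only: int_elt_add int_elt_in_carrier, simp add: elt_zero int_elt_def elt_eq_iff del: K_alg_simps)

lemma fractional_glued_ideal: "fractional_ideal (split_poly S) (glued_ideal t)"
proof -
  note D = eval_moduleD[OF eval_module_glued[of S t]]
  have "(\<lambda>c. diffs S * 0) \<in> glued S t" by (intro conductor_in_glued finite_S) (simp add: maximal_order_def)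
  then have ne: "glued S t \<noteq> {}" by blast
  have "subgroup (glued_ideal t) (add_monoid K)"
  proof (rule subgroup_add_monoidI)
    fix x assume "x \<in> glued_ideal t"
    then obtain u where u: "u \<in> glued S t" "x = int_elt S u" by blast
    have "eval_on S [:-1:] * u \<in> glued S t" by (rule D(3)[OF u(1)])
    also have "eval_on S [:-1:] * u = - u"
      using u(1) by (auto simp: glued_def maximal_order_def eval_on_def fun_eq_iff)
    finally show "\<ominus>\<^bsub>K\<^esub> x \<in> glued_ideal t" unfolding u(2) minus_int_elt by blast
  next
    fix x y assume "x \<in> glued_ideal t" "y \<in> glued_ideal t"
    then obtain u v where "u \<in> glued S t" "x = int_elt S u" "v \<in> glued S t" "y = int_elt S v" by blast
    then show "x \<oplus>\<^bsub>K\<^esub> y \<in> glued_ideal t" using int_elt_add[of u v] D(2)[of u v] by blast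
  qed (use ne int_elt_in_carrier in auto)
  moreover have "int_elt S (eval_on S p) \<otimes>\<^bsub>K\<^esub> x \<in> glued_ideal t" if x: "x \<in> glued_ideal t" for p x
    using that int_elt_mult D(3) by auto
  moreover have "(add_monoid K)\<lparr>carrier := glued_ideal t\<rparr> \<cong> free_Abelian_group {..<card S}"
  proof (rule group.iso_sym)
    let ?F = "free_Abelian_group {..<card S}"
    obtain \<phi> where \<phi>: "bij_betw \<phi> (carrier ?F) (glued S t)"
      "\<forall>p\<in>carrier ?F. \<forall>q\<in>carrier ?F. \<phi> (p + q) = \<phi> p + \<phi> q"
      using glued_free[OF finite_S, of t] by blast
    have "bij_betw (int_elt S) (glued S t) (glued_ideal t)"
      using inj_on_subset[OF int_elt_inj D(1)] by (auto simp: bij_betw_def)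
    then have b: "bij_betw (int_elt S \<circ> \<phi>) (carrier ?F) (glued_ideal t)" using \<phi>(1) bij_betw_trans by blast
    have "int_elt S \<circ> \<phi> \<in> iso ?F ((add_monoid K)\<lparr>carrier := glued_ideal t\<rparr>)"
    proof (rule isoI[OF homI])
      fix p q assume "p \<in> carrier ?F" "q \<in> carrier ?F"
      then show "(int_elt S \<circ> \<phi>) (p \<otimes>\<^bsub>?F\<^esub> q) =
        (int_elt S \<circ> \<phi>) p \<otimes>\<^bsub>(add_monoid K)\<lparr>carrier := glued_ideal t\<rparr>\<^esub> (int_elt S \<circ> \<phi>) q"
        using \<phi>(2) int_elt_add[of "\<phi> p" "\<phi> q"] by (simp del: K_alg_simps)
    qed (use b bij_betwE[OF b] in simp_all)
    then show "?F \<cong> (add_monoid K)\<lparr>carrier := glued_ideal t\<rparr>" unfolding is_iso_def by blast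
  qed simp
  ultimately show ?thesis unfolding fractional_ideal_iff by blast
qed

abbreviation "E \<equiv> ideal_equiv (split_poly S)"

lemma equiv_ideal_equiv: "equiv {I. fractional_ideal (split_poly S) I} E"
proof (rule equivI)
  show "E \<subseteq> {I. fractional_ideal (split_poly S) I} \<times> {I. fractional_ideal (split_poly S) I}"
    unfolding ideal_equiv_def by blast
  show "refl_on {I. fractional_ideal (split_poly S) I} E"
  proof (rule refl_onI)
    fix I assume "I \<in> {I. fractional_ideal (split_poly S) I}"
    moreover from this have "I = \<one>\<^bsub>K\<^esub> <#\<^bsub>K\<^esub> I"
      using l_coset_one[of I] fractional_idealD(1)[of I] by simp
    ultimately show "(I, I) \<in> E" using K.Units_one_closed unfolding ideal_equiv_def by blast
  qed
  show "sym E"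
  proof (rule symI)
    fix I J assume "(I, J) \<in> E"
    then obtain k where k: "k \<in> Units K" "I = k <#\<^bsub>K\<^esub> J" and IJ: "fractional_ideal (split_poly S) I"
      "fractional_ideal (split_poly S) J" unfolding ideal_equiv_def by blast
    have "inv\<^bsub>K\<^esub> k <#\<^bsub>K\<^esub> (k <#\<^bsub>K\<^esub> J) = (inv\<^bsub>K\<^esub> k \<otimes>\<^bsub>K\<^esub> k) <#\<^bsub>K\<^esub> J"
      by (rule l_coset_assoc) (use k(1) fractional_idealD(1)[OF IJ(2)] in blast)+
    also have "\<dots> = J"
      unfolding K.Units_l_inv[OF k(1)] by (rule l_coset_one[OF fractional_idealD(1)[OF IJ(2)]])
    finally have "J = inv\<^bsub>K\<^esub> k <#\<^bsub>K\<^esub> I" unfolding k(2) by (rule sym)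
    then show "(J, I) \<in> E" using IJ k K.Units_inv_Units unfolding ideal_equiv_def by blast
  qed
  show "trans E"
  proof (rule transI)
    fix I J L assume "(I, J) \<in> E" "(J, L) \<in> E"
    then obtain k l where k: "k \<in> Units K" "I = k <#\<^bsub>K\<^esub> J" and l: "l \<in> Units K" "J = l <#\<^bsub>K\<^esub> L"
      and IJ: "fractional_ideal (split_poly S) I" "fractional_ideal (split_poly S) L"
      unfolding ideal_equiv_def by blast
    have "I = (k \<otimes>\<^bsub>K\<^esub> l) <#\<^bsub>K\<^esub> L"
      unfolding k(2) l(2)
      by (rule l_coset_assoc) (use k(1) l(1) K.Units_closed fractional_idealD(1)[OF IJ(2)] in blast)+
    then show "(I, L) \<in> E" using IJ k l K.Units_m_closed unfolding ideal_equiv_def by blast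
  qed
qed

lemma ideal_prod_subset_carrier:
  "I \<subseteq> carrier K \<Longrightarrow> J \<subseteq> carrier K \<Longrightarrow> ideal_prod K I J \<subseteq> carrier K"
  by (rule ideal_prod_mono) (use K.m_closed K.a_closed in blast)+

lemma ideal_prod_scale:
  assumes "I \<subseteq> carrier K" "J \<subseteq> carrier K" and kl: "k \<in> carrier K" "l \<in> carrier K"
  shows "ideal_prod K (k <#\<^bsub>K\<^esub> I) (l <#\<^bsub>K\<^esub> J) = (k \<otimes>\<^bsub>K\<^esub> l) <#\<^bsub>K\<^esub> ideal_prod K I J"
proof -
  have swap: "(k \<otimes>\<^bsub>K\<^esub> x) \<otimes>\<^bsub>K\<^esub> (l \<otimes>\<^bsub>K\<^esub> y) = (k \<otimes>\<^bsub>K\<^esub> l) \<otimes>\<^bsub>K\<^esub> (x \<otimes>\<^bsub>K\<^esub> y)"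
    if "x \<in> I" "y \<in> J" for x y
  proof -
    have "x \<in> carrier K" "y \<in> carrier K" using assms that by blast+
    then show ?thesis using kl by (simp only: K.m_assoc K.m_closed K.m_lcomm)
  qed
  have distr: "(k \<otimes>\<^bsub>K\<^esub> l) \<otimes>\<^bsub>K\<^esub> (x \<oplus>\<^bsub>K\<^esub> y) = ((k \<otimes>\<^bsub>K\<^esub> l) \<otimes>\<^bsub>K\<^esub> x) \<oplus>\<^bsub>K\<^esub> ((k \<otimes>\<^bsub>K\<^esub> l) \<otimes>\<^bsub>K\<^esub> y)"
    if "x \<in> ideal_prod K I J" "y \<in> ideal_prod K I J" for x y
    using K.r_distr ideal_prod_subset_carrier[OF assms(1,2)] that K.m_closed[OF kl] by blast
  show ?thesis
  proof
    show "ideal_prod K (k <#\<^bsub>K\<^esub> I) (l <#\<^bsub>K\<^esub> J) \<subseteq> (k \<otimes>\<^bsub>K\<^esub> l) <#\<^bsub>K\<^esub> ideal_prod K I J"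
    proof (rule ideal_prod_mono)
      fix x y assume "x \<in> k <#\<^bsub>K\<^esub> I" "y \<in> l <#\<^bsub>K\<^esub> J"
      then show "x \<otimes>\<^bsub>K\<^esub> y \<in> (k \<otimes>\<^bsub>K\<^esub> l) <#\<^bsub>K\<^esub> ideal_prod K I J"
        unfolding l_coset_eq_image using swap ideal_prod.prod[of _ I _ J K] by blast
    next
      fix x y assume "x \<in> (k \<otimes>\<^bsub>K\<^esub> l) <#\<^bsub>K\<^esub> ideal_prod K I J" "y \<in> (k \<otimes>\<^bsub>K\<^esub> l) <#\<^bsub>K\<^esub> ideal_prod K I J"
      then obtain u v where uv: "u \<in> ideal_prod K I J" "v \<in> ideal_prod K I J"
        "x = (k \<otimes>\<^bsub>K\<^esub> l) \<otimes>\<^bsub>K\<^esub> u" "y = (k \<otimes>\<^bsub>K\<^esub> l) \<otimes>\<^bsub>K\<^esub> v"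
        unfolding l_coset_eq_image by blast
      show "x \<oplus>\<^bsub>K\<^esub> y \<in> (k \<otimes>\<^bsub>K\<^esub> l) <#\<^bsub>K\<^esub> ideal_prod K I J"
        unfolding l_coset_eq_image uv(3,4) distr[OF uv(1,2), symmetric]
        by (rule imageI[OF ideal_prod.sum[OF uv(1,2)]])
    qed
    have "(k \<otimes>\<^bsub>K\<^esub> l) \<otimes>\<^bsub>K\<^esub> z \<in> ideal_prod K (k <#\<^bsub>K\<^esub> I) (l <#\<^bsub>K\<^esub> J)" if "z \<in> ideal_prod K I J" for z
      using that
    proof induction
      case (prod x y)
      then have "(k \<otimes>\<^bsub>K\<^esub> x) \<otimes>\<^bsub>K\<^esub> (l \<otimes>\<^bsub>K\<^esub> y) \<in> ideal_prod K (k <#\<^bsub>K\<^esub> I) (l <#\<^bsub>K\<^esub> J)"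
        by (intro ideal_prod.prod) (auto simp: l_coset_eq_image simp del: K_alg_simps)
      then show ?case using swap[OF prod] by metis
    next
      case (sum x y)
      show ?case unfolding distr[OF sum(1,2)] by (rule ideal_prod.sum[OF sum(3,4)])
    qed
    then show "(k \<otimes>\<^bsub>K\<^esub> l) <#\<^bsub>K\<^esub> ideal_prod K I J \<subseteq> ideal_prod K (k <#\<^bsub>K\<^esub> I) (l <#\<^bsub>K\<^esub> J)"
      unfolding l_coset_eq_image by blast
  qed
qed

text \<open>The product of two classes is a union over all pairs of representatives.  Rescaling the
  representatives rescales their product, so that all members of this union are equal.\<close>
lemma ICM_mult_classes:
  assumes I: "fractional_ideal (split_poly S) I" and J: "fractional_ideal (split_poly S) J"
    and IJ: "fractional_ideal (split_poly S) (ideal_prod K I J)"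
  shows "E `` {I} \<otimes>\<^bsub>ICM (split_poly S)\<^esub> E `` {J} = E `` {ideal_prod K I J}"
proof -
  have "E `` {ideal_prod K I' J'} = E `` {ideal_prod K I J}"
    if "I' \<in> E `` {I}" "J' \<in> E `` {J}" for I' J'
  proof (rule equiv_class_eq[OF equiv_ideal_equiv])
    have "(I', I) \<in> E" "(J', J) \<in> E"
      using that equiv_ideal_equiv by (auto simp: equiv_def dest: symD)
    then obtain k l where k: "k \<in> Units K" "I' = k <#\<^bsub>K\<^esub> I" and l: "l \<in> Units K" "J' = l <#\<^bsub>K\<^esub> J"
      unfolding ideal_equiv_def by blast
    have "ideal_prod K I' J' = (k \<otimes>\<^bsub>K\<^esub> l) <#\<^bsub>K\<^esub> ideal_prod K I J"
      unfolding k(2) l(2) using ideal_prod_scale fractional_idealD(1) I J k(1) l(1) K.Units_closed by blast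
    moreover have "k \<otimes>\<^bsub>K\<^esub> l \<in> Units K" using k l K.Units_m_closed by blast
    ultimately show "(ideal_prod K I' J', ideal_prod K I J) \<in> E"
      using IJ fractional_ideal_scale[OF IJ] unfolding ideal_equiv_def by auto
  qed
  moreover have "I \<in> E `` {I}" "J \<in> E `` {J}" using equiv_class_self[OF equiv_ideal_equiv] I J by blast+
  ultimately show ?thesis unfolding ICM_def monoid.simps by blast
qed

end

section \<open>The class group of an order cut out by congruences\<close>

lemma rat_subgroup_generator:
  fixes G :: "rat set"
  assumes add: "\<And>x y. x \<in> G \<Longrightarrow> y \<in> G \<Longrightarrow> x + y \<in> G"
    and scale: "\<And>k x. x \<in> G \<Longrightarrow> of_int k * x \<in> G"
    and ex: "h \<in> G" "h \<noteq> 0" and D: "D \<noteq> 0" "\<And>x. x \<in> G \<Longrightarrow> x * D \<in> \<int>"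
  shows "\<exists>g. g \<in> G \<and> g \<noteq> 0 \<and> (\<forall>x\<in>G. \<exists>z. x = g * of_int z)"
proof -
  define H where "H = {z :: int. of_int z / D \<in> G}"
  have rep: "\<exists>z. z \<in> H \<and> x = of_int z / D" if x: "x \<in> G" for x
  proof -
    obtain z where "x * D = of_int z" using D(2)[OF x] by (auto elim: Ints_cases)
    then have "x = of_int z / D" using D(1) by (simp add: field_simps)
    then show ?thesis using x by (auto simp: H_def)
  qed
  obtain h' where h': "h' \<in> H" "h = of_int h' / D" using rep[OF ex(1)] by blast
  have "\<exists>g. g \<in> H \<and> g \<noteq> 0 \<and> (\<forall>x\<in>H. g dvd x)"
  proof (rule int_subgroup_generator)
    show "x + y \<in> H" if "x \<in> H" "y \<in> H" for x y
      using add that by (simp add: H_def add_divide_distrib)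
    show "k * x \<in> H" if "x \<in> H" for k x
      using scale[of "of_int x / D" k] that by (simp add: H_def)
    show "h' \<in> H" "h' \<noteq> 0" using h' ex by auto
  qed
  then obtain g where g: "g \<in> H" "g \<noteq> 0" "\<forall>x\<in>H. g dvd x" by blast
  have "\<exists>w. x = of_int g / D * of_int w" if "x \<in> G" for x
  proof -
    obtain z where z: "z \<in> H" "x = of_int z / D" using rep \<open>x \<in> G\<close> by blast
    then obtain w where "z = g * w" using g(3) by blast
    then show ?thesis using z by auto
  qed
  then show ?thesis using g D(1) by (intro exI[of _ "of_int g / D"]) (auto simp: H_def)
qed

lemma glued_cong:
  assumes "\<And>b c. b \<in> S \<Longrightarrow> c \<in> S \<Longrightarrow> b < c \<Longrightarrow> [t b c = s b c] (mod (c - b))"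
  shows "glued S t = glued S s"
proof -
  have "[u b = t b c * u c] (mod (c - b)) \<longleftrightarrow> [u b = s b c * u c] (mod (c - b))"
    if "b \<in> S" "c \<in> S" "b < c" for b c u
    using cong_mult[OF assms[OF that] cong_refl, of "u c"] by (meson cong_sym cong_trans)
  then show ?thesis unfolding glued_def by auto
qed

text \<open>The two properties of \<open>S\<close> on which the computation of the class group rests.  The first says that
  the order is given by the pairwise congruences; the second is a Chinese remainder property, which
  makes every twist locally principal.  Both follow if the differences of the roots are pairwise
  coprime.\<close>
locale split_order = finite_roots +
  assumes glued_1_subset: "glued S (\<lambda>_ _. 1) \<subseteq> range (eval_on S)"
    and lift: "\<And>t. unit_family S t \<Longrightarrow> \<exists>\<alpha>\<in>glued S t. \<forall>c\<in>S. coprime (\<alpha> c) (diffs S)"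
begin

lemma range_eval_on: "range (eval_on S) = glued S (\<lambda>_ _. 1)"
  using glued_1_subset eval_on_glued by blast

lemma unit_ideal_eq_glued: "unit_ideal (split_poly S) = glued_ideal (\<lambda>_ _. 1)"
  by (simp add: unit_ideal_eq range_eval_on)

definition glued_class :: "(int \<Rightarrow> int \<Rightarrow> int) \<Rightarrow> rat poly set set set" where
  "glued_class t = E `` {glued_ideal t}"

lemma ideal_prod_glued_ideal:
  "unit_family S t \<Longrightarrow> ideal_prod K (glued_ideal t) (glued_ideal s) = glued_ideal (\<lambda>b c. t b c * s b c)"
  unfolding ideal_prod_int_elt using lift[of t] prod_glued[OF finite_S] by blast

lemma glued_class_mult:
  assumes "unit_family S t"
  shows "glued_class t \<otimes>\<^bsub>Cl (split_poly S)\<^esub> glued_class s = glued_class (\<lambda>b c. t b c * s b c)"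
  using ICM_mult_classes[OF fractional_glued_ideal[of t] fractional_glued_ideal[of s]]
    fractional_glued_ideal ideal_prod_glued_ideal[OF assms]
  by (simp add: Cl_def glued_class_def del: K_alg_simps)

lemma one_Cl: "\<one>\<^bsub>Cl (split_poly S)\<^esub> = glued_class (\<lambda>_ _. 1)"
  by (simp add: Cl_def ICM_def glued_class_def unit_ideal_eq_glued)

lemma unit_family_inverse:
  assumes "unit_family S t"
  obtains s where "unit_family S s" "\<And>b c. b \<in> S \<Longrightarrow> c \<in> S \<Longrightarrow> b < c \<Longrightarrow> [t b c * s b c = 1] (mod (c - b))"
proof -
  have "\<forall>b c. \<exists>x. b \<in> S \<longrightarrow> c \<in> S \<longrightarrow> b < c \<longrightarrow> [t b c * x = 1] (mod (c - b))"
    using assms cong_solve_coprime_int unfolding unit_family_def by blast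
  then obtain s where s: "\<And>b c. b \<in> S \<Longrightarrow> c \<in> S \<Longrightarrow> b < c \<Longrightarrow> [t b c * s b c = 1] (mod (c - b))"
    by metis
  then have "unit_family S s"
    unfolding unit_family_def by (metis coprime_iff_invertible_int mult.commute)
  then show ?thesis using that s by blast
qed

lemma invertible_glued_ideal:
  assumes "unit_family S t"
  shows "invertible_ideal (split_poly S) (glued_ideal t)"
proof -
  obtain s where s: "unit_family S s"
    "\<And>b c. b \<in> S \<Longrightarrow> c \<in> S \<Longrightarrow> b < c \<Longrightarrow> [t b c * s b c = 1] (mod (c - b))"
    using unit_family_inverse[OF assms] by blast
  have "ideal_prod K (glued_ideal t) (glued_ideal s) = unit_ideal (split_poly S)"
    unfolding ideal_prod_glued_ideal[OF assms] unit_ideal_eq_glued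
    using glued_cong[of S "\<lambda>b c. t b c * s b c" "\<lambda>_ _. 1"] s(2) by simp
  then show ?thesis unfolding invertible_ideal_def using fractional_glued_ideal by blast
qed

definition coord :: "rat poly set \<Rightarrow> int \<Rightarrow> rat" where
  "coord x = (SOME u. elt S u = x)"

lemma elt_coord: "x \<in> carrier K \<Longrightarrow> elt S (coord x) = x"
  unfolding carrier_K coord_def using someI[of "\<lambda>u. elt S u = x"] by blast

lemma coord_elt: "c \<in> S \<Longrightarrow> coord (elt S u) c = u c"
  using elt_coord[OF elt_in_carrier] elt_eq_iff by metis

lemma coord_mult: "x \<in> carrier K \<Longrightarrow> y \<in> carrier K \<Longrightarrow> c \<in> S \<Longrightarrow> coord (x \<otimes>\<^bsub>K\<^esub> y) c = coord x c * coord y c"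
  unfolding carrier_K using elt_mult coord_elt by auto

lemma coord_add: "x \<in> carrier K \<Longrightarrow> y \<in> carrier K \<Longrightarrow> c \<in> S \<Longrightarrow> coord (x \<oplus>\<^bsub>K\<^esub> y) c = coord x c + coord y c"
  unfolding carrier_K using elt_add coord_elt by auto

lemma coord_int_elt: "c \<in> S \<Longrightarrow> coord (int_elt S u) c = of_int (u c)"
  unfolding int_elt_def by (rule coord_elt)

text \<open>The projection of \<open>I\<close> to the coordinate \<open>c\<close> is a subgroup of \<open>\<rat>\<close>.  It is not zero because
  \<open>1 \<in> I J\<close>, and an element of \<open>J\<close> with nonzero coordinate at \<open>c\<close> bounds its denominators because
  \<open>I J\<close> is integral.  Hence it is cyclic.\<close>
lemma coord_generator:
  assumes I: "fractional_ideal (split_poly S) I" and J: "fractional_ideal (split_poly S) J"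
    and IJ: "ideal_prod K I J = unit_ideal (split_poly S)" and c: "c \<in> S"
  shows "\<exists>g. g \<noteq> 0 \<and> (\<exists>x\<in>I. coord x c = g) \<and> (\<forall>x\<in>I. \<exists>z. coord x c = g * of_int z)"
proof -
  note DI = fractional_idealD[OF I] and DJ = fractional_idealD[OF J]
  have "\<exists>x\<in>I. \<exists>y\<in>J. coord x c * coord y c \<noteq> 0"
  proof (rule ccontr)
    assume *: "\<not> ?thesis"
    have "ideal_prod K I J \<subseteq> {z \<in> carrier K. coord z c = 0}"
    proof (rule ideal_prod_mono)
      fix x y assume "x \<in> I" "y \<in> J"
      then show "x \<otimes>\<^bsub>K\<^esub> y \<in> {z \<in> carrier K. coord z c = 0}"
        using coord_mult[OF subsetD[OF DI(1)] subsetD[OF DJ(1)] c] * K.m_closed[OF subsetD[OF DI(1)] subsetD[OF DJ(1)]]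
        by (simp del: K_alg_simps) blast
    next
      fix x y assume "x \<in> {z \<in> carrier K. coord z c = 0}" "y \<in> {z \<in> carrier K. coord z c = 0}"
      then show "x \<oplus>\<^bsub>K\<^esub> y \<in> {z \<in> carrier K. coord z c = 0}"
        using coord_add[of x y c] c K.a_closed[of x y] by (auto simp del: K_alg_simps)
    qed
    moreover have "int_elt S (eval_on S 1) \<in> ideal_prod K I J" unfolding IJ unit_ideal_eq by blast
    ultimately have "coord (int_elt S (eval_on S 1)) c = 0" by blast
    then show False using c by (simp add: coord_int_elt eval_on_def)
  qed
  then obtain x\<^sub>0 y\<^sub>0 where xy: "x\<^sub>0 \<in> I" "y\<^sub>0 \<in> J" "coord x\<^sub>0 c \<noteq> 0" "coord y\<^sub>0 c \<noteq> 0" by auto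
  have "\<exists>g. g \<in> (\<lambda>x. coord x c) ` I \<and> g \<noteq> 0 \<and> (\<forall>x\<in>(\<lambda>x. coord x c) ` I. \<exists>z. x = g * of_int z)"
  proof (rule rat_subgroup_generator)
    fix x y assume "x \<in> (\<lambda>x. coord x c) ` I" "y \<in> (\<lambda>x. coord x c) ` I"
    then obtain u v where uv: "u \<in> I" "v \<in> I" "x = coord u c" "y = coord v c" by blast
    then have "x + y = coord (u \<oplus>\<^bsub>K\<^esub> v) c" using coord_add[OF subsetD[OF DI(1)] subsetD[OF DI(1)] c] by (simp del: K_alg_simps)
    then show "x + y \<in> (\<lambda>x. coord x c) ` I" using DI(3) uv by blast
  next
    fix k x assume "x \<in> (\<lambda>x. coord x c) ` I"
    then obtain u where u: "u \<in> I" "x = coord u c" by blast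
    then have "coord (int_elt S (eval_on S [:k:]) \<otimes>\<^bsub>K\<^esub> u) c = of_int k * x"
      using coord_mult[OF int_elt_in_carrier subsetD[OF DI(1) u(1)] c] coord_int_elt[OF c] c
      by (simp add: eval_on_def del: K_alg_simps)
    then show "of_int k * x \<in> (\<lambda>x. coord x c) ` I" using DI(5)[OF u(1)] by (metis imageI)
  next
    fix x assume "x \<in> (\<lambda>x. coord x c) ` I"
    then obtain u where u: "u \<in> I" "x = coord u c" by blast
    have "u \<otimes>\<^bsub>K\<^esub> y\<^sub>0 \<in> unit_ideal (split_poly S)" using ideal_prod.prod[OF u(1) xy(2), of K] IJ by simp
    then have "coord (u \<otimes>\<^bsub>K\<^esub> y\<^sub>0) c \<in> \<int>" unfolding unit_ideal_eq using coord_int_elt[OF c] by auto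
    then show "x * coord y\<^sub>0 c \<in> \<int>" using coord_mult[OF subsetD[OF DI(1) u(1)] subsetD[OF DJ(1) xy(2)] c] u(2) by (simp del: K_alg_simps)
  qed (use xy in auto)
  then show ?thesis by (auto simp: image_iff) 
qed

text \<open>After division by the generators of all coordinate projections, \<open>I\<close> and the correspondingly
  rescaled inverse consist of integer vectors, and \<open>invertible_eval_module_is_glued\<close> applies.\<close>
lemma invertible_ideal_equiv_glued:
  assumes "invertible_ideal (split_poly S) I"
  shows "\<exists>t. unit_family S t \<and> (I, glued_ideal t) \<in> E"
proof -
  obtain J where I: "fractional_ideal (split_poly S) I" and J: "fractional_ideal (split_poly S) J"
    and IJ: "ideal_prod K I J = unit_ideal (split_poly S)"
    using assms unfolding invertible_ideal_def by blast
  note DI = fractional_idealD[OF I] and DJ = fractional_idealD[OF J]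
  obtain g where g: "\<And>c. c \<in> S \<Longrightarrow> g c \<noteq> 0" "\<And>c. c \<in> S \<Longrightarrow> \<exists>x\<in>I. coord x c = g c"
    "\<And>c x. c \<in> S \<Longrightarrow> x \<in> I \<Longrightarrow> \<exists>z. coord x c = g c * of_int z"
    using coord_generator[OF I J IJ] by metis
  define h where "h = (\<lambda>c. 1 / g c)"
  define k l where "k = elt S g" and "l = elt S h"
  have k: "k \<in> Units K" "k \<in> carrier K" and l: "l \<in> carrier K"
    unfolding k_def l_def using elt_Units_iff g(1) elt_in_carrier by blast+
  have kl: "k \<otimes>\<^bsub>K\<^esub> l = \<one>\<^bsub>K\<^esub>"
    unfolding k_def l_def elt_mult elt_one elt_eq_iff using g(1) by (auto simp: h_def)
  define A where "A = {u \<in> maximal_order S. k \<otimes>\<^bsub>K\<^esub> int_elt S u \<in> I}"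
  define B where "B = {u \<in> maximal_order S. l \<otimes>\<^bsub>K\<^esub> int_elt S u \<in> J}"
  have integral: "\<exists>u. u \<in> maximal_order S \<and> x = elt S f \<otimes>\<^bsub>K\<^esub> int_elt S u"
    if x: "x \<in> carrier K" and z: "\<And>c. c \<in> S \<Longrightarrow> \<exists>z. coord x c = f c * of_int z" for x f
  proof -
    obtain z where "\<And>c. c \<in> S \<Longrightarrow> coord x c = f c * of_int (z c)" using z by metis
    then have "elt S (coord x) = elt S f \<otimes>\<^bsub>K\<^esub> int_elt S (\<lambda>c. if c \<in> S then z c else 0)"
      unfolding int_elt_def elt_mult elt_eq_iff by simp
    then show ?thesis using elt_coord[OF x] by (intro exI[of _ "\<lambda>c. if c \<in> S then z c else 0"]) (simp add: maximal_order_def)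
  qed
  have IA: "I = k <#\<^bsub>K\<^esub> (int_elt S ` A)"
  proof
    show "I \<subseteq> k <#\<^bsub>K\<^esub> (int_elt S ` A)"
    proof
      fix x assume x: "x \<in> I"
      then obtain u where "u \<in> maximal_order S" "x = k \<otimes>\<^bsub>K\<^esub> int_elt S u"
        unfolding k_def using integral[of x g] DI(1) g(3) by blast
      then show "x \<in> k <#\<^bsub>K\<^esub> (int_elt S ` A)" using x unfolding l_coset_eq_image A_def by blast
    qed
  qed (auto simp: l_coset_eq_image A_def simp del: K_alg_simps)
  have JB: "J = l <#\<^bsub>K\<^esub> (int_elt S ` B)"
  proof
    show "J \<subseteq> l <#\<^bsub>K\<^esub> (int_elt S ` B)"
    proof
      fix y assume y: "y \<in> J"
      have "\<exists>z. coord y c = h c * of_int z" if c: "c \<in> S" for c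
      proof -
        obtain x where x: "x \<in> I" "coord x c = g c" using g(2) c by blast
        have "x \<otimes>\<^bsub>K\<^esub> y \<in> unit_ideal (split_poly S)" using ideal_prod.prod[OF x(1) y, of K] IJ by simp
        then obtain v where "x \<otimes>\<^bsub>K\<^esub> y = int_elt S v" unfolding unit_ideal_eq by blast
        then have "g c * coord y c = of_int (v c)"
          using coord_mult[OF subsetD[OF DI(1) x(1)] subsetD[OF DJ(1) y] c] coord_int_elt[OF c, of v] x(2)
          by (simp del: K_alg_simps)
        then show ?thesis using g(1)[OF c] by (intro exI[of _ "v c"]) (simp add: h_def field_simps)
      qed
      then obtain u where "u \<in> maximal_order S" "y = l \<otimes>\<^bsub>K\<^esub> int_elt S u"
        unfolding l_def using integral[of y h] DJ(1) y by blast
      then show "y \<in> l <#\<^bsub>K\<^esub> (int_elt S ` B)" using y unfolding l_coset_eq_image B_def by blast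
    qed
  qed (auto simp: l_coset_eq_image B_def simp del: K_alg_simps)
  have module: "eval_module S {u \<in> maximal_order S. m \<otimes>\<^bsub>K\<^esub> int_elt S u \<in> L}"
    if m: "m \<in> carrier K" and L: "fractional_ideal (split_poly S) L" for m L
    unfolding eval_module_def
  proof (intro conjI ballI allI)
    fix u v assume uv: "u \<in> {u \<in> maximal_order S. m \<otimes>\<^bsub>K\<^esub> int_elt S u \<in> L}" "v \<in> {u \<in> maximal_order S. m \<otimes>\<^bsub>K\<^esub> int_elt S u \<in> L}"
    have "m \<otimes>\<^bsub>K\<^esub> int_elt S (u + v) = (m \<otimes>\<^bsub>K\<^esub> int_elt S u) \<oplus>\<^bsub>K\<^esub> (m \<otimes>\<^bsub>K\<^esub> int_elt S v)"
      unfolding int_elt_add[symmetric] by (intro K.r_distr int_elt_in_carrier m)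
    also have "\<dots> \<in> L" using fractional_idealD(3)[OF L] uv by blast
    finally show "u + v \<in> {u \<in> maximal_order S. m \<otimes>\<^bsub>K\<^esub> int_elt S u \<in> L}"
      using uv by (simp add: maximal_order_def del: K_alg_simps)
  next
    fix p u assume u: "u \<in> {u \<in> maximal_order S. m \<otimes>\<^bsub>K\<^esub> int_elt S u \<in> L}"
    have "m \<otimes>\<^bsub>K\<^esub> int_elt S (eval_on S p * u) = int_elt S (eval_on S p) \<otimes>\<^bsub>K\<^esub> (m \<otimes>\<^bsub>K\<^esub> int_elt S u)"
      unfolding int_elt_mult[symmetric] by (intro K.m_lcomm int_elt_in_carrier m)
    also have "\<dots> \<in> L" using fractional_idealD(5)[OF L] u by blast
    finally show "eval_on S p * u \<in> {u \<in> maximal_order S. m \<otimes>\<^bsub>K\<^esub> int_elt S u \<in> L}"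
      using u by (simp add: maximal_order_def del: K_alg_simps)
  qed auto
  have A: "eval_module S A" and B: "eval_module S B"
    unfolding A_def B_def using module k(2) l I J by blast+
  have sub: "int_elt S ` Z \<subseteq> carrier K" for Z using int_elt_in_carrier by blast
  have "int_elt S ` ideal_prod fun_ring A B = (k \<otimes>\<^bsub>K\<^esub> l) <#\<^bsub>K\<^esub> (int_elt S ` ideal_prod fun_ring A B)"
    unfolding kl by (rule l_coset_one[OF sub, symmetric])
  also have "\<dots> = ideal_prod K I J"
    unfolding ideal_prod_int_elt[symmetric] ideal_prod_scale[OF sub sub k(2) l, symmetric] IA[symmetric] JB[symmetric] ..
  also have "\<dots> = int_elt S ` range (eval_on S)" unfolding IJ unit_ideal_eq ..
  finally have AB: "ideal_prod fun_ring A B = range (eval_on S)"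
  proof (rule inj_on_image_eq_iff[OF int_elt_inj, THEN iffD1, rotated 2])
    show "ideal_prod fun_ring A B \<subseteq> maximal_order S"
      using A B by (intro ideal_prod_mono) (auto simp: eval_module_def maximal_order_def subset_iff)
  qed auto
  have one: "\<exists>u\<in>A. u c = 1" if c: "c \<in> S" for c
  proof -
    obtain x where x: "x \<in> I" "coord x c = g c" using g(2) c by blast
    then obtain u where u: "u \<in> A" "x = k \<otimes>\<^bsub>K\<^esub> int_elt S u" using IA unfolding l_coset_eq_image by blast
    have "coord x c = g c * of_int (u c)"
      unfolding u(2) k_def using coord_mult[OF elt_in_carrier int_elt_in_carrier c] coord_elt[OF c] coord_int_elt[OF c] by simp
    then have "u c = 1" using x(2) g(1)[OF c] by simp
    then show ?thesis using u(1) by blast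
  qed
  obtain t where t: "unit_family S t" "A = glued S t"
    using invertible_eval_module_is_glued[OF finite_S A B AB glued_1_subset one] by blast
  have "I = k <#\<^bsub>K\<^esub> glued_ideal t" using IA t(2) by blast
  then have "(I, glued_ideal t) \<in> E"
    using I fractional_glued_ideal k(1) unfolding ideal_equiv_def by blast
  then show ?thesis using t(1) by blast
qed

lemma carrier_Cl: "carrier (Cl (split_poly S)) = {glued_class t | t. unit_family S t}"
proof (intro equalityI subsetI)
  fix Z assume "Z \<in> carrier (Cl (split_poly S))"
  then obtain I where I: "invertible_ideal (split_poly S) I" "Z = E `` {I}" unfolding Cl_def by auto
  then obtain t where "unit_family S t" "(I, glued_ideal t) \<in> E" using invertible_ideal_equiv_glued by blast
  then show "Z \<in> {glued_class t | t. unit_family S t}"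
    using equiv_class_eq[OF equiv_ideal_equiv] I(2) unfolding glued_class_def by blast
qed (use invertible_glued_ideal in \<open>auto simp: Cl_def glued_class_def\<close>)

text \<open>Suppose that \<open>\<sigma>\<close> generates \<open>glued S t\<close>.  Then \<open>\<sigma> c\<close> divides the coordinate at \<open>c\<close> of every
  element, in particular the discriminant and a number prime to it, so \<open>\<sigma> c = \<plusminus>1\<close>.  Since \<open>\<sigma>\<close> itself
  is in \<open>glued S t\<close>, it follows that \<open>t b c \<equiv> \<sigma> b \<cdot> \<sigma> c\<close>.  Conversely, multiplication by such a sign
  vector is an involution that exchanges the order and its twist.\<close>
lemma glued_class_eq_one_iff:
  assumes t: "unit_family S t"
  shows "glued_class t = glued_class (\<lambda>_ _. 1) \<longleftrightarrow>
    (\<exists>\<sigma>. (\<forall>c\<in>S. \<bar>\<sigma> c\<bar> = 1) \<and> (\<forall>b\<in>S. \<forall>c\<in>S. b < c \<longrightarrow> [t b c = \<sigma> b * \<sigma> c] (mod (c - b))))"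
proof
  let ?R = "glued S (\<lambda>_ _. 1)"
  assume "glued_class t = glued_class (\<lambda>_ _. 1)"
  then have "(glued_ideal t, glued_ideal (\<lambda>_ _. 1)) \<in> E"
    unfolding glued_class_def using eq_equiv_class[OF _ equiv_ideal_equiv] fractional_glued_ideal by blast
  then obtain k where k: "k \<in> Units K" "glued_ideal t = k <#\<^bsub>K\<^esub> glued_ideal (\<lambda>_ _. 1)"
    unfolding ideal_equiv_def by blast
  have "k \<otimes>\<^bsub>K\<^esub> int_elt S (eval_on S 1) \<in> glued_ideal t"
    unfolding k(2) l_coset_eq_image using eval_on_glued by blast
  moreover have "int_elt S (eval_on S 1) = \<one>\<^bsub>K\<^esub>"
    unfolding int_elt_def elt_one elt_eq_iff by (simp add: eval_on_def)
  ultimately have "k \<in> glued_ideal t" using K.r_one K.Units_closed[OF k(1)] by metis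
  then obtain \<sigma> where \<sigma>: "\<sigma> \<in> glued S t" "k = int_elt S \<sigma>" by blast
  have dvd: "\<sigma> c dvd u c" if "u \<in> glued S t" "c \<in> S" for u c
  proof -
    have "int_elt S u \<in> k <#\<^bsub>K\<^esub> glued_ideal (\<lambda>_ _. 1)" using that k(2) by blast
    then obtain r where "int_elt S u = int_elt S (\<sigma> * r)"
      unfolding l_coset_eq_image \<sigma>(2) using int_elt_mult by auto
    then have "of_int (u c) = (of_int (\<sigma> c * r c) :: rat)" using that(2) by (simp add: int_elt_def elt_eq_iff)
    then have "u c = \<sigma> c * r c" by (simp only: of_int_eq_iff)
    then show ?thesis by simp
  qed
  obtain \<alpha> where \<alpha>: "\<alpha> \<in> glued S t" "\<forall>c\<in>S. coprime (\<alpha> c) (diffs S)" using lift[OF t] by blast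
  have unit: "\<bar>\<sigma> c\<bar> = 1" if c: "c \<in> S" for c
  proof -
    have "(\<lambda>c. diffs S * (if c \<in> S then 1 else 0)) \<in> glued S t"
      by (intro conductor_in_glued finite_S) (auto simp: maximal_order_def)
    then have "\<sigma> c dvd diffs S" using dvd[OF _ c] c by fastforce
    then have "\<sigma> c dvd 1" using dvd[OF \<alpha>(1) c] \<alpha>(2) c coprime_common_divisor by blast
    then show ?thesis by simp
  qed
  have "[t b c = \<sigma> b * \<sigma> c] (mod (c - b))" if bc: "b \<in> S" "c \<in> S" "b < c" for b c
  proof -
    have "[\<sigma> b * \<sigma> c = t b c * \<sigma> c * \<sigma> c] (mod (c - b))"
      using \<sigma>(1) bc by (intro cong_mult) (auto simp: glued_def)
    moreover have "\<sigma> c * \<sigma> c = 1" using unit[OF bc(2)] by (metis abs_mult_self_eq mult_1)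
    ultimately show ?thesis by (simp add: mult.assoc cong_sym)
  qed
  then show "\<exists>\<sigma>. (\<forall>c\<in>S. \<bar>\<sigma> c\<bar> = 1) \<and> (\<forall>b\<in>S. \<forall>c\<in>S. b < c \<longrightarrow> [t b c = \<sigma> b * \<sigma> c] (mod (c - b)))"
    using unit by blast
next
  assume "\<exists>\<sigma>. (\<forall>c\<in>S. \<bar>\<sigma> c\<bar> = 1) \<and> (\<forall>b\<in>S. \<forall>c\<in>S. b < c \<longrightarrow> [t b c = \<sigma> b * \<sigma> c] (mod (c - b)))"
  then obtain \<sigma> where \<sigma>: "\<And>c. c \<in> S \<Longrightarrow> \<bar>\<sigma> c\<bar> = 1"
    "\<And>b c. b \<in> S \<Longrightarrow> c \<in> S \<Longrightarrow> b < c \<Longrightarrow> [t b c = \<sigma> b * \<sigma> c] (mod (c - b))" by blast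
  have sq: "\<sigma> c * \<sigma> c = 1" if "c \<in> S" for c using \<sigma>(1)[OF that] by (metis abs_mult_self_eq mult_1)
  define \<tau> where "\<tau> = (\<lambda>c. if c \<in> S then \<sigma> c else 0)"
  have \<tau>: "\<tau> \<in> glued S (\<lambda>b c. \<sigma> b * \<sigma> c)"
    using sq by (auto simp: \<tau>_def glued_def maximal_order_def mult.assoc)
  have tt: "glued S t = glued S (\<lambda>b c. \<sigma> b * \<sigma> c)" using \<sigma>(2) by (intro glued_cong)
  have "glued S t = (\<lambda>u. \<tau> * u) ` glued S (\<lambda>_ _. 1)"
  proof (intro equalityI subsetI)
    fix u assume u: "u \<in> glued S t"
    have "\<tau> * u \<in> glued S (\<lambda>b c. (\<sigma> b * \<sigma> c) * (\<sigma> b * \<sigma> c))" using glued_mult[OF \<tau>] u tt by blast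
    also have "\<dots> = glued S (\<lambda>_ _. 1)"
    proof (rule glued_cong)
      fix b c assume "b \<in> S" "c \<in> S"
      then have "(\<sigma> b * \<sigma> c) * (\<sigma> b * \<sigma> c) = 1"
        using sq by (metis (no_types, opaque_lifting) mult.assoc mult.commute mult_1)
      then show "[(\<sigma> b * \<sigma> c) * (\<sigma> b * \<sigma> c) = 1] (mod (c - b))" by simp
    qed
    finally have 1: "\<tau> * u \<in> glued S (\<lambda>_ _. 1)" .
    have "\<tau> c * (\<tau> c * u c) = u c" for c
      using u sq[of c] by (auto simp: \<tau>_def glued_def maximal_order_def mult.assoc[symmetric])
    then have "u = \<tau> * (\<tau> * u)" by (simp add: fun_eq_iff)
    then show "u \<in> (\<lambda>u. \<tau> * u) ` glued S (\<lambda>_ _. 1)" using 1 by blast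
  next
    fix u assume "u \<in> (\<lambda>u. \<tau> * u) ` glued S (\<lambda>_ _. 1)"
    then show "u \<in> glued S t" using glued_mult[OF \<tau>, of _ "\<lambda>_ _. 1"] tt by auto
  qed
  then have "glued_ideal t = int_elt S \<tau> <#\<^bsub>K\<^esub> glued_ideal (\<lambda>_ _. 1)"
    unfolding l_coset_eq_image image_image int_elt_mult by (simp add: image_image)
  moreover have "int_elt S \<tau> \<in> Units K"
    unfolding int_elt_def elt_Units_iff using \<sigma>(1) by (fastforce simp: \<tau>_def)
  ultimately have "(glued_ideal t, glued_ideal (\<lambda>_ _. 1)) \<in> E"
    unfolding ideal_equiv_def using fractional_glued_ideal by blast
  then show "glued_class t = glued_class (\<lambda>_ _. 1)"
    unfolding glued_class_def by (rule equiv_class_eq[OF equiv_ideal_equiv])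
qed

end

section \<open>Two and three roots\<close>

lemma coprime_diffsI:
  assumes "\<And>b c. b \<in> S \<Longrightarrow> c \<in> S \<Longrightarrow> b < c \<Longrightarrow> coprime x (c - b)"
  shows "coprime x (diffs S)"
  unfolding diffs_def
proof (intro prod_coprime_right)
  fix b c assume "b \<in> S" "c \<in> S - {b}"
  then have "coprime x (c - b) \<or> coprime x (- (c - b))"
    using assms[of b c] assms[of c b] by (cases "b < c") auto
  then show "coprime x (c - b)" by (metis coprime_minus_right_iff)
qed

text \<open>Newton interpolation with one divided difference; the lift of \<open>t\<close> is the vector \<open>(t, 1)\<close>.\<close>
lemma split_order_2:
  assumes "a < b"
  shows "split_order {a, b}"
proof
  show "finite {a, b}" by simp
  show "glued {a, b} (\<lambda>_ _. 1) \<subseteq> range (eval_on {a, b})"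
  proof
    fix u assume u: "u \<in> glued {a, b} (\<lambda>_ _. 1)"
    then have "b - a dvd u b - u a" using assms by (auto simp: glued_def cong_iff_dvd_diff dvd_diff_commute)
    then obtain w where w: "u b - u a = (b - a) * w" by blast
    have "u = eval_on {a, b} ([:u a:] + [:- a, 1:] * [:w:])"
      using u w by (auto simp: eval_on_def glued_def maximal_order_def fun_eq_iff algebra_simps)
    then show "u \<in> range (eval_on {a, b})" by blast
  qed
next
  fix t assume t: "unit_family {a, b} t"
  show "\<exists>\<alpha>\<in>glued {a, b} t. \<forall>c\<in>{a, b}. coprime (\<alpha> c) (diffs {a, b})"
  proof (intro bexI ballI)
    let ?\<alpha> = "\<lambda>c. if c = a then t a b else if c = b then 1 else 0"
    show "?\<alpha> \<in> glued {a, b} t" using assms by (auto simp: glued_def maximal_order_def)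
    fix c assume "c \<in> {a, b}"
    then show "coprime (?\<alpha> c) (diffs {a, b})"
      using t assms by (intro coprime_diffsI) (auto simp: unit_family_def)
  qed
qed

lemma chinese_remainder_3:
  fixes m\<^sub>1 m\<^sub>2 m\<^sub>3 :: int
  assumes "coprime m\<^sub>1 m\<^sub>2" "coprime m\<^sub>1 m\<^sub>3" "coprime m\<^sub>2 m\<^sub>3"
  shows "\<exists>x. [x = u\<^sub>1] (mod m\<^sub>1) \<and> [x = u\<^sub>2] (mod m\<^sub>2) \<and> [x = u\<^sub>3] (mod m\<^sub>3)"
proof -
  obtain y where y: "[y = u\<^sub>1] (mod m\<^sub>1)" "[y = u\<^sub>2] (mod m\<^sub>2)"
    using binary_chinese_remainder_int assms(1) by blast
  obtain x where x: "[x = y] (mod m\<^sub>1 * m\<^sub>2)" "[x = u\<^sub>3] (mod m\<^sub>3)"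
    using binary_chinese_remainder_int[of "m\<^sub>1 * m\<^sub>2" m\<^sub>3] assms by auto
  have "[x = y] (mod m\<^sub>1)" "[x = y] (mod m\<^sub>2)" using x(1) by (auto intro: cong_dvd_modulus)
  then show ?thesis using x(2) y cong_trans by blast
qed

text \<open>Of \<open>c - a = (b - a) + (c - b)\<close> any two terms are coprime as soon as the two summands are.  The
  numerator \<open>r\<close> of the second divided difference is divisible by \<open>c - a\<close> and by \<open>c - b\<close> separately,
  by the congruences for the pairs \<open>(a, c)\<close> and \<open>(b, c)\<close>, hence by their product.\<close>
lemma split_order_3:
  assumes ab: "a < b" and bc: "b < c" and cop: "coprime (b - a) (c - b)"
  shows "split_order {a, b, c}"
proof
  have cop2: "coprime (b - a) (c - a)" "coprime (c - b) (c - a)"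
  proof -
    have *: "c - a = (b - a) + (c - b)" "c - a = (c - b) + (b - a)" by simp_all
    show "coprime (b - a) (c - a)" unfolding *(1) coprime_iff_gcd_eq_1 gcd_add2
      using cop unfolding coprime_iff_gcd_eq_1 .
    show "coprime (c - b) (c - a)" unfolding *(2) coprime_iff_gcd_eq_1 gcd_add2
      using cop unfolding coprime_iff_gcd_eq_1 gcd.commute[of "b - a"] .
  qed
  show "finite {a, b, c}" by simp
  show "glued {a, b, c} (\<lambda>_ _. 1) \<subseteq> range (eval_on {a, b, c})"
  proof
    fix u assume u: "u \<in> glued {a, b, c} (\<lambda>_ _. 1)"
    have d: "b - a dvd u b - u a" "c - a dvd u c - u a" "c - b dvd u c - u b"
      using u ab bc by (auto simp: glued_def cong_iff_dvd_diff dvd_diff_commute)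
    obtain w where w: "u b - u a = (b - a) * w" using d(1) by blast
    \<comment> \<open>\<open>w\<close> is the first divided difference of \<open>u\<close>, and \<open>v\<close> below is the second one\<close>
    let ?r = "u c - u a - (c - a) * w"
    have "c - a dvd ?r" using d(2) by simp
    moreover have "c - b dvd ?r"
    proof -
      have "?r = (u c - u b) - (c - b) * w" using w by (simp add: algebra_simps)
      also have "c - b dvd \<dots>" using d(3) by simp
      finally show ?thesis .
    qed
    ultimately have "(c - a) * (c - b) dvd ?r" using cop2(2) by (simp add: divides_mult coprime_commute)
    then obtain v where v: "?r = (c - a) * (c - b) * v" by blast
    have "u = eval_on {a, b, c} ([:u a:] + [:- a, 1:] * ([:w:] + [:- b, 1:] * [:v:]))"
      (is "u = eval_on _ ?p")
    proof
      fix x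
      have p: "poly ?p y = u a + (y - a) * (w + (y - b) * v)" for y by (simp add: algebra_simps)
      have pa: "poly ?p a = u a" unfolding p by simp
      have pb: "poly ?p b = u b" unfolding p using w by simp
      have pc: "poly ?p c = u c" unfolding p using v by (simp add: algebra_simps)
      show "u x = eval_on {a, b, c} ?p x"
      proof (cases "x \<in> {a, b, c}")
        case True
        then have "poly ?p x = u x" using pa pb pc by blast
        then show ?thesis using True by (simp only: eval_on_def if_True)
      next
        case False
        have "u \<in> maximal_order {a, b, c}" using u by (simp only: glued_def mem_Collect_eq)
        then have "u x = 0" using False unfolding maximal_order_def by blast
        then show ?thesis using False by (simp only: eval_on_def if_False)
      qed
    qed
    then show "u \<in> range (eval_on {a, b, c})" by blast
  qed
  fix t assume t: "unit_family {a, b, c} t"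
  \<comment> \<open>The lift is \<open>(\<gamma>, \<beta>, 1)\<close>.  As \<open>\<beta> \<equiv> 1\<close> modulo \<open>b - a\<close>, the congruence for the pair \<open>(a, b)\<close> becomes
    \<open>\<gamma> \<equiv> t a b\<close>; modulo the differences not involved in any condition the value \<open>1\<close> makes the
    coordinates units.\<close>
  obtain \<beta> where \<beta>: "[\<beta> = t b c] (mod (c - b))" "[\<beta> = 1] (mod (b - a))" "[\<beta> = 1] (mod (c - a))"
    using chinese_remainder_3[of "c - b" "b - a" "c - a" "t b c" 1 1] cop cop2 by (auto simp: coprime_commute)
  obtain \<gamma> where \<gamma>: "[\<gamma> = 1] (mod (c - b))" "[\<gamma> = t a b] (mod (b - a))" "[\<gamma> = t a c] (mod (c - a))"
    using chinese_remainder_3[of "c - b" "b - a" "c - a" 1 "t a b" "t a c"] cop cop2 by (auto simp: coprime_commute)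
  have tu: "coprime (t a b) (b - a)" "coprime (t a c) (c - a)" "coprime (t b c) (c - b)"
    using t ab bc by (auto simp: unit_family_def)
  have cong_coprime: "[x = y] (mod m) \<Longrightarrow> coprime y m \<Longrightarrow> coprime x m" for x y m :: int
    using cong_imp_coprime cong_sym by blast
  have co: "coprime \<beta> (c - b)" "coprime \<beta> (b - a)" "coprime \<beta> (c - a)"
    "coprime \<gamma> (c - b)" "coprime \<gamma> (b - a)" "coprime \<gamma> (c - a)"
    using \<beta> \<gamma> tu by (auto intro: cong_coprime)
  have "[t a b * 1 = t a b * \<beta>] (mod (b - a))" by (intro cong_mult cong_refl cong_sym[OF \<beta>(2)])
  then have ab': "[\<gamma> = t a b * \<beta>] (mod (b - a))" using cong_trans[OF \<gamma>(2)] by simp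
  show "\<exists>\<alpha>\<in>glued {a, b, c} t. \<forall>x\<in>{a, b, c}. coprime (\<alpha> x) (diffs {a, b, c})"
  proof (intro bexI ballI)
    let ?\<alpha> = "\<lambda>x. if x = a then \<gamma> else if x = b then \<beta> else if x = c then 1 else 0"
    show "?\<alpha> \<in> glued {a, b, c} t"
      using ab bc ab' \<beta>(1) \<gamma>(3) by (auto simp: glued_def maximal_order_def)
    fix x assume "x \<in> {a, b, c}"
    then show "coprime (?\<alpha> x) (diffs {a, b, c})"
      using ab bc co by (intro coprime_diffsI) auto
  qed
qed

lemma ZMod_eq: "ZMod m x = {k. [k = x] (mod m)}"
  unfolding ZMod_def int.cgenideal_eq_genideal[of m, simplified, symmetric]
  by (auto simp: cgenideal_def a_r_coset_def' cong_iff_dvd_diff dvd_def algebra_simps)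

lemma ZFact_ops:
  "carrier (ZFact m) = range (ZMod m)" "\<one>\<^bsub>ZFact m\<^esub> = ZMod m 1"
  "ZMod m x \<otimes>\<^bsub>ZFact m\<^esub> ZMod m y = ZMod m (x * y)"
  "ZMod m x \<oplus>\<^bsub>ZFact m\<^esub> ZMod m y = ZMod m (x + y)"
  "\<zero>\<^bsub>ZFact m\<^esub> = ZMod m 0"
proof -
  interpret ideal "Idl\<^bsub>\<Z>\<^esub> {m}" \<Z> by (rule int.genideal_ideal) simp
  show "carrier (ZFact m) = range (ZMod m)" "\<one>\<^bsub>ZFact m\<^esub> = ZMod m 1"
    by (auto simp: ZFact_defs ZMod_def A_RCOSETS_def')
  show "ZMod m x \<otimes>\<^bsub>ZFact m\<^esub> ZMod m y = ZMod m (x * y)"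
    using rcoset_mult_add[of x y] by (simp add: ZFact_defs ZMod_def)
  show "ZMod m x \<oplus>\<^bsub>ZFact m\<^esub> ZMod m y = ZMod m (x + y)"
    using a_rcos_sum[of x y] by (simp add: ZFact_defs ZMod_def)
  show "\<zero>\<^bsub>ZFact m\<^esub> = ZMod m 0"
    by (simp add: ZFact_defs ZMod_def)
qed

lemma ZMod_eq_iff: "ZMod m x = ZMod m y \<longleftrightarrow> [x = y] (mod m)"
  unfolding ZMod_eq_mod cong_def ..

lemma neg1_eq: "neg1 m = ZMod m (- 1)"
proof -
  interpret cring "ZFact m" by (rule ZFact_is_cring)
  show ?thesis by (rule minus_equality) (auto simp: ZFact_ops)
qed

lemma carrier_ZUnits: "carrier (ZUnits m) = ZMod m ` {x. coprime x m}"
proof -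
  have "ZMod m x \<in> Units (ZFact m) \<longleftrightarrow> coprime x m" for x
    unfolding Units_def coprime_iff_invertible_int
    by (auto simp: ZFact_ops ZMod_eq_iff mult.commute)
  then show ?thesis
    unfolding units_of_carrier using ZFact_ops(1)[of m] by (auto simp: Units_def)
qed

lemma group_ZUnits: "group (ZUnits m)"
proof -
  interpret cring "ZFact m" by (rule ZFact_is_cring)
  show ?thesis by (rule units_group)
qed

text \<open>A representative of a residue class.  The choice is harmless because \<open>glued S t\<close> depends only on
  the classes of the \<open>t b c\<close>.\<close>
definition rep :: "int set \<Rightarrow> int" where
  "rep Z = (SOME z. z \<in> Z)"

lemma rep_ZMod: "[rep (ZMod m x) = x] (mod m)"
proof -
  have "rep (ZMod m x) \<in> ZMod m x" unfolding rep_def by (rule someI[of _ x]) (simp add: ZMod_eq)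
  then show ?thesis by (simp add: ZMod_eq)
qed

lemma rep_ZUnits:
  assumes "Z \<in> carrier (ZUnits m)"
  shows "ZMod m (rep Z) = Z" "coprime (rep Z) m"
proof -
  obtain x where x: "Z = ZMod m x" "coprime x m" using assms unfolding carrier_ZUnits by blast
  then show "ZMod m (rep Z) = Z" using rep_ZMod[of m x] by (simp add: ZMod_eq_iff)
  show "coprime (rep Z) m" using x rep_ZMod[of m x] cong_imp_coprime cong_sym by blast
qed

lemma rep_mult:
  assumes "Y \<in> carrier (ZUnits m)" "Z \<in> carrier (ZUnits m)"
  shows "[rep (Y \<otimes>\<^bsub>ZUnits m\<^esub> Z) = rep Y * rep Z] (mod m)"
proof -
  have "Y \<otimes>\<^bsub>ZUnits m\<^esub> Z = ZMod m (rep Y * rep Z)"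
    using rep_ZUnits(1)[OF assms(1)] rep_ZUnits(1)[OF assms(2)] ZFact_ops(3) by (metis units_of_mult)
  then show ?thesis using rep_ZMod by metis
qed

lemma rep_eq_pos1_iff: "Z \<in> carrier (ZUnits m) \<Longrightarrow> Z = pos1 m \<longleftrightarrow> [rep Z = 1] (mod m)"
  and rep_eq_neg1_iff: "Z \<in> carrier (ZUnits m) \<Longrightarrow> Z = neg1 m \<longleftrightarrow> [rep Z = - 1] (mod m)"
  using rep_ZUnits(1)[of Z m] by (metis ZFact_ops(2) ZMod_eq_iff, metis neg1_eq ZMod_eq_iff)

lemma pos1_neg1_in_ZUnits: "pos1 m \<in> carrier (ZUnits m)" "neg1 m \<in> carrier (ZUnits m)"
  using neg1_eq[of m] by (auto simp: carrier_ZUnits ZFact_ops(2))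

text \<open>The first isomorphism theorem in a form that does not presuppose that \<open>H\<close> is a group: as a
  homomorphic image of one, it is.  The class group is therefore a group without a separate proof.\<close>
lemma iso_Mod_kernel:
  assumes G: "group G" and h: "h \<in> hom G H" "h ` carrier G = carrier H" "h \<one>\<^bsub>G\<^esub> = \<one>\<^bsub>H\<^esub>"
    and N: "N = {x \<in> carrier G. h x = \<one>\<^bsub>H\<^esub>}"
  shows "(H :: 'b monoid) \<cong> G Mod N"
proof -
  have "group (H \<lparr> carrier := h ` carrier G, one := h \<one>\<^bsub>G\<^esub> \<rparr>)"
    by (rule group.hom_imp_img_group[OF G h(1)])
  then have H: "group H" unfolding h by simp
  interpret group_hom G H h using G H h(1) by (simp add: group_hom_def group_hom_axioms_def)
  have N': "N = kernel G H h" unfolding N kernel_def ..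
  have "G Mod N \<cong> H" unfolding N' by (rule FactGroup_iso[OF h(2)])
  moreover have "group (G Mod N)"
    unfolding N' by (rule normal.factorgroup_is_group[OF normal_kernel])
  ultimately show ?thesis using group.iso_sym by blast
qed

lemma (in split_order) glued_class_cong:
  "(\<And>b c. b \<in> S \<Longrightarrow> c \<in> S \<Longrightarrow> b < c \<Longrightarrow> [t b c = s b c] (mod (c - b))) \<Longrightarrow> glued_class t = glued_class s"
  unfolding glued_class_def using glued_cong[of S t s] by simp

lemma sign_iff: "\<bar>x\<bar> = 1 \<longleftrightarrow> x \<in> {1, - 1 :: int}"
  by auto

theorem Cl_two_roots:
  assumes ab: "a < b"
  shows "Cl (split_poly {a, b}) \<cong> ZUnits (b - a) Mod {pos1 (b - a), neg1 (b - a)}"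
proof -
  interpret split_order "{a, b}" by (rule split_order_2[OF ab])
  let ?G = "ZUnits (b - a)"
  define h where "h Z = glued_class (\<lambda>_ _. rep Z)" for Z
  have unit: "unit_family {a, b} (\<lambda>_ _. rep Z)" if "Z \<in> carrier ?G" for Z
    using rep_ZUnits(2)[OF that] ab by (auto simp: unit_family_def)
  have h_ZMod: "h (ZMod (b - a) x) = glued_class (\<lambda>_ _. x)" for x
    unfolding h_def by (rule glued_class_cong) (use rep_ZMod[of "b - a" x] ab in auto)
  show ?thesis
  proof (rule iso_Mod_kernel[where h = h])
    show "group ?G" by (rule group_ZUnits)
    show "h \<in> hom ?G (Cl (split_poly {a, b}))"
    proof (rule homI)
      fix Y Z assume YZ: "Y \<in> carrier ?G" "Z \<in> carrier ?G"
      have "h (Y \<otimes>\<^bsub>?G\<^esub> Z) = glued_class (\<lambda>_ _. rep Y * rep Z)"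
        unfolding h_def by (rule glued_class_cong) (use rep_mult[OF YZ] ab in auto)
      then show "h (Y \<otimes>\<^bsub>?G\<^esub> Z) = h Y \<otimes>\<^bsub>Cl (split_poly {a, b})\<^esub> h Z"
        unfolding h_def glued_class_mult[OF unit[OF YZ(1)]] .
    qed (use unit in \<open>auto simp: carrier_Cl h_def\<close>)
    show "h ` carrier ?G = carrier (Cl (split_poly {a, b}))"
    proof
      show "carrier (Cl (split_poly {a, b})) \<subseteq> h ` carrier ?G"
      proof
        fix C assume "C \<in> carrier (Cl (split_poly {a, b}))"
        then obtain t where t: "unit_family {a, b} t" "C = glued_class t" unfolding carrier_Cl by blast
        have "h (ZMod (b - a) (t a b)) = C" unfolding h_ZMod t(2) by (rule glued_class_cong) (use ab in auto)
        moreover have "ZMod (b - a) (t a b) \<in> carrier ?G" using t(1) ab by (auto simp: carrier_ZUnits unit_family_def)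
        ultimately show "C \<in> h ` carrier ?G" by blast
      qed
    qed (use unit in \<open>auto simp: carrier_Cl h_def\<close>)
    show "h \<one>\<^bsub>?G\<^esub> = \<one>\<^bsub>Cl (split_poly {a, b})\<^esub>"
      unfolding one_Cl units_of_one ZFact_ops h_ZMod ..
    show "{pos1 (b - a), neg1 (b - a)} = {Z \<in> carrier ?G. h Z = \<one>\<^bsub>Cl (split_poly {a, b})\<^esub>}"
    proof -
      have "h Z = \<one>\<^bsub>Cl (split_poly {a, b})\<^esub> \<longleftrightarrow> Z = pos1 (b - a) \<or> Z = neg1 (b - a)"
        if Z: "Z \<in> carrier ?G" for Z
      proof -
        have "h Z = \<one>\<^bsub>Cl (split_poly {a, b})\<^esub> \<longleftrightarrow>
          (\<exists>\<sigma>. \<bar>\<sigma> a\<bar> = 1 \<and> \<bar>\<sigma> b\<bar> = 1 \<and> [rep Z = \<sigma> a * \<sigma> b] (mod (b - a)))"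
          unfolding h_def one_Cl glued_class_eq_one_iff[OF unit[OF Z]] using ab by auto
        also have "\<dots> \<longleftrightarrow> [rep Z = 1] (mod (b - a)) \<or> [rep Z = - 1] (mod (b - a))"
        proof
          assume "[rep Z = 1] (mod (b - a)) \<or> [rep Z = - 1] (mod (b - a))"
          then obtain e :: int where "\<bar>e\<bar> = 1" "[rep Z = e] (mod (b - a))" unfolding sign_iff by blast
          then show "\<exists>\<sigma>. \<bar>\<sigma> a\<bar> = 1 \<and> \<bar>\<sigma> b\<bar> = 1 \<and> [rep Z = \<sigma> a * \<sigma> b] (mod (b - a))"
            using ab by (intro exI[of _ "\<lambda>c. if c = a then e else 1"]) auto
        qed (auto simp: sign_iff)
        finally show ?thesis using rep_eq_pos1_iff[OF Z] rep_eq_neg1_iff[OF Z] by simp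
      qed
      then show ?thesis using pos1_neg1_in_ZUnits by blast
    qed
  qed
qed

text \<open>The kernel of \<open>h\<close> consists of the triples of classes of \<open>\<sigma> a \<cdot> \<sigma> b\<close>, \<open>\<sigma> b \<cdot> \<sigma> c\<close> and \<open>\<sigma> a \<cdot> \<sigma> c\<close>.  With
  \<open>d = \<sigma> a \<cdot> \<sigma> b\<close> and \<open>e = \<sigma> b \<cdot> \<sigma> c\<close> these are the triples \<open>(d, e, d e)\<close>, and \<open>d\<close>, \<open>e\<close> are arbitrary
  signs.\<close>
theorem Cl_three_roots:
  assumes ab: "a < b" and bc: "b < c" and cop: "coprime (b - a) (c - b)"
  shows "Cl (split_poly {a, b, c}) \<cong>
    (ZUnits (b - a) \<times>\<times> ZUnits (c - b) \<times>\<times> ZUnits (c - a)) Mod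
      {(pos1 (b - a), pos1 (c - b), pos1 (c - a)), (pos1 (b - a), neg1 (c - b), neg1 (c - a)),
       (neg1 (b - a), pos1 (c - b), neg1 (c - a)), (neg1 (b - a), neg1 (c - b), pos1 (c - a))}"
    (is "?Cl \<cong> ?G Mod ?N")
proof -
  interpret split_order "{a, b, c}" by (rule split_order_3[OF ab bc cop])
  \<comment> \<open>The family with entries \<open>x\<close>, \<open>y\<close>, \<open>z\<close> at the pairs \<open>(a, b)\<close>, \<open>(b, c)\<close>, \<open>(a, c)\<close>\<close>
  define fam where "fam x y z = (\<lambda>p q. if p = a then if q = b then x else z else y)" for x y z :: int
  have fam_cong: "glued_class (fam x y z) = glued_class t"
    if "[x = t a b] (mod (b - a))" "[y = t b c] (mod (c - b))" "[z = t a c] (mod (c - a))" for x y z t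
    by (rule glued_class_cong) (use that ab bc in \<open>auto simp: fam_def\<close>)
  define h where "h = (\<lambda>(U, V, W). glued_class (fam (rep U) (rep V) (rep W)))"
  have unit: "unit_family {a, b, c} (fam (rep U) (rep V) (rep W))"
    if "(U, V, W) \<in> carrier ?G" for U V W
    using rep_ZUnits(2)[of U "b - a"] rep_ZUnits(2)[of V "c - b"] rep_ZUnits(2)[of W "c - a"] that ab bc
    by (auto simp: unit_family_def fam_def)
  have h_ZMod: "h (ZMod (b - a) x, ZMod (c - b) y, ZMod (c - a) z) = glued_class (fam x y z)" for x y z
    unfolding h_def prod.case
    by (rule fam_cong) (use rep_ZMod ab bc in \<open>auto simp: fam_def\<close>)
  show ?thesis
  proof (rule iso_Mod_kernel[where h = h])
    show "group ?G" by (intro DirProd_group group_ZUnits)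
    show "h \<in> hom ?G ?Cl"
    proof (rule homI)
      fix P Q assume PQ: "P \<in> carrier ?G" "Q \<in> carrier ?G"
      obtain U V W where P: "P = (U, V, W)" by (cases P)
      obtain U' V' W' where Q: "Q = (U', V', W')" by (cases Q)
      have "h (P \<otimes>\<^bsub>?G\<^esub> Q) = glued_class (\<lambda>p q. fam (rep U) (rep V) (rep W) p q * fam (rep U') (rep V') (rep W') p q)"
        unfolding h_def P Q mult_DirProd prod.case
        by (rule fam_cong) (use rep_mult[of U "b - a" U'] rep_mult[of V "c - b" V'] rep_mult[of W "c - a" W'] PQ ab bc in
          \<open>auto simp: fam_def P Q\<close>)
      then show "h (P \<otimes>\<^bsub>?G\<^esub> Q) = h P \<otimes>\<^bsub>?Cl\<^esub> h Q"
        using PQ(1) unfolding h_def P Q prod.case by (subst glued_class_mult[OF unit]) auto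
    qed (use unit in \<open>auto simp: carrier_Cl h_def\<close>)
    show "h ` carrier ?G = carrier ?Cl"
    proof
      show "carrier ?Cl \<subseteq> h ` carrier ?G"
      proof
        fix C assume "C \<in> carrier ?Cl"
        then obtain t where t: "unit_family {a, b, c} t" "C = glued_class t" unfolding carrier_Cl by blast
        have "h (ZMod (b - a) (t a b), ZMod (c - b) (t b c), ZMod (c - a) (t a c)) = C"
          unfolding h_ZMod t(2) by (rule fam_cong) auto
        moreover have "(ZMod (b - a) (t a b), ZMod (c - b) (t b c), ZMod (c - a) (t a c)) \<in> carrier ?G"
          using t(1) ab bc by (auto simp: carrier_ZUnits unit_family_def)
        ultimately show "C \<in> h ` carrier ?G" by blast
      qed
    qed (use unit in \<open>auto simp: carrier_Cl h_def\<close>)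
    show "h \<one>\<^bsub>?G\<^esub> = \<one>\<^bsub>?Cl\<^esub>"
      unfolding one_Cl one_DirProd units_of_one ZFact_ops h_ZMod by (rule fam_cong) auto
    have ker: "h (U, V, W) = \<one>\<^bsub>?Cl\<^esub> \<longleftrightarrow> (U, V, W) \<in> ?N" if G: "(U, V, W) \<in> carrier ?G" for U V W
    proof -
      have UVW: "U \<in> carrier (ZUnits (b - a))" "V \<in> carrier (ZUnits (c - b))" "W \<in> carrier (ZUnits (c - a))"
        using G by auto
      have "h (U, V, W) = \<one>\<^bsub>?Cl\<^esub> \<longleftrightarrow>
        (\<exists>\<sigma>. (\<bar>\<sigma> a\<bar> = 1 \<and> \<bar>\<sigma> b\<bar> = 1 \<and> \<bar>\<sigma> c\<bar> = 1) \<and> [rep U = \<sigma> a * \<sigma> b] (mod (b - a)) \<and>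
          [rep V = \<sigma> b * \<sigma> c] (mod (c - b)) \<and> [rep W = \<sigma> a * \<sigma> c] (mod (c - a)))"
        unfolding h_def prod.case one_Cl glued_class_eq_one_iff[OF unit[OF G]] using ab bc by (auto simp: fam_def)
      also have "\<dots> \<longleftrightarrow> (\<exists>d e. \<bar>d\<bar> = 1 \<and> \<bar>e\<bar> = 1 \<and> [rep U = d] (mod (b - a)) \<and>
          [rep V = e] (mod (c - b)) \<and> [rep W = d * e] (mod (c - a)))"
      proof
        assume "\<exists>\<sigma>. (\<bar>\<sigma> a\<bar> = 1 \<and> \<bar>\<sigma> b\<bar> = 1 \<and> \<bar>\<sigma> c\<bar> = 1) \<and> [rep U = \<sigma> a * \<sigma> b] (mod (b - a)) \<and>
          [rep V = \<sigma> b * \<sigma> c] (mod (c - b)) \<and> [rep W = \<sigma> a * \<sigma> c] (mod (c - a))"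
        then obtain \<sigma> where \<sigma>: "\<bar>\<sigma> a\<bar> = 1" "\<bar>\<sigma> b\<bar> = 1" "\<bar>\<sigma> c\<bar> = 1" "[rep U = \<sigma> a * \<sigma> b] (mod (b - a))"
          "[rep V = \<sigma> b * \<sigma> c] (mod (c - b))" "[rep W = \<sigma> a * \<sigma> c] (mod (c - a))" by blast
        have abs_ab: "\<bar>\<sigma> a * \<sigma> b\<bar> = 1" and abs_bc: "\<bar>\<sigma> b * \<sigma> c\<bar> = 1"
          using \<sigma>(1-3) by (simp_all add: abs_mult)
        have "(\<sigma> a * \<sigma> b) * (\<sigma> b * \<sigma> c) = \<sigma> a * \<sigma> c" using \<sigma>(2) unfolding sign_iff by auto
        then have W: "[rep W = (\<sigma> a * \<sigma> b) * (\<sigma> b * \<sigma> c)] (mod (c - a))" using \<sigma>(6) by (simp only:)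
        show "\<exists>d e. \<bar>d\<bar> = 1 \<and> \<bar>e\<bar> = 1 \<and> [rep U = d] (mod (b - a)) \<and>
          [rep V = e] (mod (c - b)) \<and> [rep W = d * e] (mod (c - a))"
          using abs_ab abs_bc \<sigma>(4,5) W by blast
      next
        assume "\<exists>d e. \<bar>d\<bar> = 1 \<and> \<bar>e\<bar> = 1 \<and> [rep U = d] (mod (b - a)) \<and>
          [rep V = e] (mod (c - b)) \<and> [rep W = d * e] (mod (c - a))"
        then obtain d e where "\<bar>d\<bar> = 1" "\<bar>e\<bar> = 1" "[rep U = d] (mod (b - a))"
          "[rep V = e] (mod (c - b))" "[rep W = d * e] (mod (c - a))" by blast
        then show "\<exists>\<sigma>. (\<bar>\<sigma> a\<bar> = 1 \<and> \<bar>\<sigma> b\<bar> = 1 \<and> \<bar>\<sigma> c\<bar> = 1) \<and> [rep U = \<sigma> a * \<sigma> b] (mod (b - a)) \<and>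
          [rep V = \<sigma> b * \<sigma> c] (mod (c - b)) \<and> [rep W = \<sigma> a * \<sigma> c] (mod (c - a))"
          using ab bc by (intro exI[of _ "\<lambda>x. if x = a then d else if x = b then 1 else e"]) auto
      qed
      also have "\<dots> \<longleftrightarrow> (\<exists>d\<in>{1, - 1}. \<exists>e\<in>{1, - 1}. [rep U = d] (mod (b - a)) \<and>
          [rep V = e] (mod (c - b)) \<and> [rep W = d * e] (mod (c - a)))"
        unfolding sign_iff Bex_def by blast
      also have "\<dots> \<longleftrightarrow> (U, V, W) \<in> ?N"
        unfolding insert_iff empty_iff prod.inject UVW[THEN rep_eq_pos1_iff] UVW[THEN rep_eq_neg1_iff]
          bex_simps mult_1_left mult_1_right mult_minus_left mult_minus_right minus_minus
        by blast
      finally show ?thesis .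
    qed
    have sub: "?N \<subseteq> carrier ?G" using pos1_neg1_in_ZUnits by simp
    show "?N = {P \<in> carrier ?G. h P = \<one>\<^bsub>?Cl\<^esub>}"
    proof (intro equalityI subsetI)
      fix P assume P: "P \<in> ?N"
      obtain U V W where "P = (U, V, W)" by (cases P)
      then show "P \<in> {P \<in> carrier ?G. h P = \<one>\<^bsub>?Cl\<^esub>}"
        using P subsetD[OF sub P] ker[of U V W] by (simp only: mem_Collect_eq)
    next
      fix P assume P: "P \<in> {P \<in> carrier ?G. h P = \<one>\<^bsub>?Cl\<^esub>}"
      obtain U V W where UVW: "P = (U, V, W)" by (cases P)
      have "(U, V, W) \<in> carrier ?G" "h (U, V, W) = \<one>\<^bsub>?Cl\<^esub>" using P UVW by simp_all
      then show "P \<in> ?N" unfolding UVW by (rule iffD1[OF ker])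
    qed
  qed
qed

lemma chi_eq_split_poly: "inj_on a {1..n} \<Longrightarrow> chi a n = split_poly (a ` {1..n})"
  unfolding chi_def split_poly_def by (simp add: prod.reindex)

theorem theorem1p4:
  fixes a :: "nat \<Rightarrow> int" and n :: nat
  assumes "strict_mono_on {1..n} a"
  shows "(n = 2 \<and> a 2 - a 1 \<ge> 3 \<longrightarrow>
      Cl (chi a n) \<cong> ZUnits (a 2 - a 1) Mod {pos1 (a 2 - a 1), neg1 (a 2 - a 1)})
    \<and> (n = 3 \<and> a 3 - a 1 \<ge> 4 \<and> Gcd {a 2 - a 1, a 3 - a 1, a 3 - a 2} = 1 \<longrightarrow>
      Cl (chi a n) \<cong>
        (ZUnits (a 2 - a 1) \<times>\<times> ZUnits (a 3 - a 2) \<times>\<times> ZUnits (a 3 - a 1)) Mod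
        {(pos1 (a 2 - a 1), pos1 (a 3 - a 2), pos1 (a 3 - a 1)),
         (pos1 (a 2 - a 1), neg1 (a 3 - a 2), neg1 (a 3 - a 1)),
         (neg1 (a 2 - a 1), pos1 (a 3 - a 2), neg1 (a 3 - a 1)),
         (neg1 (a 2 - a 1), neg1 (a 3 - a 2), pos1 (a 3 - a 1))})"
proof (intro conjI impI)
  have mono: "a i < a j" if "1 \<le> i" "i < j" "j \<le> n" for i j
    using strict_mono_onD[OF assms, of i j] that by simp
  have chi: "chi a n = split_poly (a ` {1..n})"
    by (intro chi_eq_split_poly strict_mono_on_imp_inj_on assms)
  {
    assume "n = 2 \<and> a 2 - a 1 \<ge> 3"
    then have n: "n = 2" by blast
    have "a ` {1..n} = {a 1, a 2}" unfolding n by (auto simp: numeral_2_eq_2 atLeastAtMostSuc_conv)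
    then show "Cl (chi a n) \<cong> ZUnits (a 2 - a 1) Mod {pos1 (a 2 - a 1), neg1 (a 2 - a 1)}"
      unfolding chi using Cl_two_roots[of "a 1" "a 2"] mono n by simp
  next
    assume "n = 3 \<and> a 3 - a 1 \<ge> 4 \<and> Gcd {a 2 - a 1, a 3 - a 1, a 3 - a 2} = 1"
    then have n: "n = 3" and gcd: "Gcd {a 2 - a 1, a 3 - a 1, a 3 - a 2} = 1" by blast+
    have "a ` {1..n} = {a 1, a 2, a 3}"
      unfolding n by (auto simp: numeral_3_eq_3 numeral_2_eq_2 atLeastAtMostSuc_conv)
    moreover have "coprime (a 2 - a 1) (a 3 - a 2)"
    proof (rule coprimeI)
      fix d assume d: "d dvd a 2 - a 1" "d dvd a 3 - a 2"
      then have "d dvd (a 2 - a 1) + (a 3 - a 2)" by (rule dvd_add)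
      then have "d dvd Gcd {a 2 - a 1, a 3 - a 1, a 3 - a 2}" using d by (intro Gcd_greatest) auto
      then show "is_unit d" unfolding gcd .
    qed
    ultimately show "Cl (chi a n) \<cong>
        (ZUnits (a 2 - a 1) \<times>\<times> ZUnits (a 3 - a 2) \<times>\<times> ZUnits (a 3 - a 1)) Mod
        {(pos1 (a 2 - a 1), pos1 (a 3 - a 2), pos1 (a 3 - a 1)),
         (pos1 (a 2 - a 1), neg1 (a 3 - a 2), neg1 (a 3 - a 1)),
         (neg1 (a 2 - a 1), pos1 (a 3 - a 2), neg1 (a 3 - a 1)),
         (neg1 (a 2 - a 1), neg1 (a 3 - a 2), pos1 (a 3 - a 1))}"
      unfolding chi using Cl_three_roots[of "a 1" "a 2" "a 3"] mono n by simp
  }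
qed

end
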